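(* Let $(w(k):k\ge1)$ be a sequence of nonnegative real numbers and assume that $$\rho:=\Big(\limsup_{k\to\infty}w(k)^{1/k}\Big)^{-1}>0.$$ Fix $b\in(0,\rho)$, set $$a=\Big(\sum_{k=0}^\infty(k+1)w(k+1)b^k\Big)^{-1}\qquad\text{and}\qquad c=\Big(\sum_{k=1}^\infty w(k)b^k\Big)^{-1},$$ and define $$\mu(k)=a(k+1)w(k+1)b^k\quad(k\ge0),\qquad \mu_\varnothing(k)=c\,w(k)b^k\quad(k\ge1).$$ Then, for every $n$ such that $Z_n^w>0$, the law of the shape of a noncrossing tree sampled according to $\mathbb{P}_n^w$ is $\mathrm{BGW}_n^{\mu_\varnothing,\mu}$.
   Context: **Noncrossing trees.** A noncrossing tree with $n$ vertices is a tree drawn in the closed unit disk whose vertices are the $n$-th roots of unity and whose edges are straight line segments which do not cross (distinct edges may only meet at a common endpoint). $\mathbb{NC}_n$ is the set of noncrossing trees with $n$ vertices. The shape of a noncrossing tree is the plane (rooted ordered) tree it carries, rooted at the vertex $1\in\mathbb{C}$; explicitly, giving the vertex $e^{-2i\pi p/n}$ the label $p\in\{0,\dots,n-1\}$, the children of each vertex are ordered by increasing label. **Simply generated noncrossing trees.** Set $\Omega^w(\theta)=\prod_{u\in\theta}w(\deg u)$ (product over the vertices of $\theta$, $\deg$ being the graph degree), $Z_n^w=\sum_{\theta\in\mathbb{NC}_n}\Omega^w(\theta)$ and, when $Z_n^w>0$, $\mathbb{P}_n^w(\theta)=\Omega^w(\theta)/Z_n^w$ for $\theta\in\mathbb{NC}_n$.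 Since $w$ is only defined on $\{1,2,\dots\}$, one takes $n\ge2$. **Modified Bienaymé–Galton–Watson trees.** $\mathrm{BGW}^{\mu_\varnothing,\mu}$ is the law of the Bienaymé–Galton–Watson plane tree in which the root has offspring distribution $\mu_\varnothing$ and all other vertices have offspring distribution $\mu$ (independently): a finite plane tree $\tau$ has mass $\mu_\varnothing(k_\varnothing)\prod_{u\in\tau\setminus\{\varnothing\}}\mu(k_u)$, where $\varnothing$ is the root and $k_u$ is the number of children of $u$. $\mathrm{BGW}_n^{\mu_\varnothing,\mu}$ is this law conditioned on the tree having $n$ vertices. *)

theory Defs
  imports "HOL-Probability.Probability"
begin

datatype plane_tree = PNode (subtrees: "plane_tree list")

primrec num_vertices :: "plane_tree \<Rightarrow> nat" where
  "num_vertices (PNode ts) = Suc (sum_list (map num_vertices ts))"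

text \<open>
  Graphs on the \<open>n\<close>-th roots of unity are given by their edge sets \<open>E :: nat set set\<close>, where the
  number \<open>p < n\<close> stands for the root of unity with label \<open>p\<close>; in particular \<open>0\<close> stands for the
  complex number \<open>1\<close>.
\<close>

definition vertex :: "nat \<Rightarrow> nat \<Rightarrow> complex" where
  "vertex n p = exp (- 2 * \<i> * of_real pi * of_nat p / of_nat n)"

definition is_tree :: "'v set \<Rightarrow> 'v set set \<Rightarrow> bool" where
  "is_tree V E \<longleftrightarrow>
     E \<subseteq> {{u, v} | u v. u \<in> V \<and> v \<in> V \<and> u \<noteq> v} \<and>
     V \<noteq> {} \<and> (\<forall>u\<in>V. \<forall>v\<in>V. (u, v) \<in> {(x, y). {x, y} \<in> E}\<^sup>*) \<and>
     \<not> (\<exists>cs. length cs \<ge> 3 \<and> distinct cs \<and>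
           (\<forall>i<length cs. {cs ! i, cs ! (Suc i mod length cs)} \<in> E))"

definition noncrossing :: "nat \<Rightarrow> nat set set \<Rightarrow> bool" where
  "noncrossing n E \<longleftrightarrow>
     (\<forall>p q r s. {p, q} \<in> E \<longrightarrow> {r, s} \<in> E \<longrightarrow> {p, q} \<noteq> {r, s} \<longrightarrow>
        closed_segment (vertex n p) (vertex n q) \<inter> closed_segment (vertex n r) (vertex n s)
          \<subseteq> vertex n ` ({p, q} \<inter> {r, s}))"

definition NC :: "nat \<Rightarrow> nat set set set" where
  "NC n = {E. is_tree {..<n} E \<and> noncrossing n E}"

text \<open>
  The children of \<open>u\<close> are its neighbours other than its parent, by increasing label; the root has
  parent \<open>None\<close>.
\<close>

definition children :: "nat set set \<Rightarrow> nat option \<Rightarrow> nat \<Rightarrow> nat list" where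
  "children E parent u = sorted_list_of_set {v. {u, v} \<in> E \<and> Some v \<noteq> parent}"

text \<open>
  The first argument bounds the number of generations and only serves to make the recursion
  terminate: a tree with \<open>n\<close> vertices has at most \<open>n\<close> generations.
\<close>

primrec subtree_at :: "nat \<Rightarrow> nat set set \<Rightarrow> nat option \<Rightarrow> nat \<Rightarrow> plane_tree" where
  "subtree_at 0 E parent u = PNode []"
| "subtree_at (Suc h) E parent u = PNode (map (subtree_at h E (Some u)) (children E parent u))"

definition shape :: "nat \<Rightarrow> nat set set \<Rightarrow> plane_tree" where
  "shape n E = subtree_at n E None 0"

definition degree :: "'v set set \<Rightarrow> 'v \<Rightarrow> nat" where
  "degree E u = card {e\<in>E. u \<in> e}"

definition weight :: "(nat \<Rightarrow> real) \<Rightarrow> nat \<Rightarrow> nat set set \<Rightarrow> real" where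
  "weight w n E = (\<Prod>u<n. w (degree E u))"

definition Z :: "(nat \<Rightarrow> real) \<Rightarrow> nat \<Rightarrow> real" where
  "Z w n = (\<Sum>E\<in>NC n. weight w n E)"

definition P_NC :: "(nat \<Rightarrow> real) \<Rightarrow> nat \<Rightarrow> nat set set pmf" where
  "P_NC w n = embed_pmf (\<lambda>E. if E \<in> NC n then weight w n E / Z w n else 0)"

lemma NC_subset: "E \<in> NC n \<Longrightarrow> E \<subseteq> Pow {..<n}"
  unfolding NC_def is_tree_def by blast

lemma finite_NC: "finite (NC n)"
  by (rule finite_subset[of _ "Pow (Pow {..<n})"]) (use NC_subset in auto)

lemma degree_NC_ge_1:
  assumes E: "E \<in> NC n" and n: "n \<ge> 2" and u: "u < n"
  shows "degree E u \<ge> 1"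
proof -
  define v :: nat where "v = (if u = 0 then 1 else 0)"
  have v: "v < n" "v \<noteq> u" using n u by (auto simp: v_def)
  have "\<forall>u\<in>{..<n}. \<forall>v\<in>{..<n}. (u, v) \<in> {(x, y). {x, y} \<in> E}\<^sup>*"
    using E unfolding NC_def is_tree_def by blast
  then have "(u, v) \<in> {(x, y). {x, y} \<in> E}\<^sup>*" using v u by simp
  then obtain y where y: "{u, y} \<in> E"
    using v(2) by (cases rule: converse_rtranclE) auto
  have "finite E"
    by (rule finite_subset[OF NC_subset[OF E]]) simp
  then have "finite {e \<in> E. u \<in> e}" by simp
  moreover have "{u, y} \<in> {e \<in> E. u \<in> e}" using y by simp
  ultimately have "card {e \<in> E. u \<in> e} > 0" using card_gt_0_iff by blast
  then show ?thesis unfolding degree_def by simp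
qed

lemma pmf_P_NC:
  assumes "\<And>k. k \<ge> 1 \<Longrightarrow> w k \<ge> 0" "n \<ge> 2" "Z w n > 0"
  shows "pmf (P_NC w n) E = (if E \<in> NC n then weight w n E / Z w n else 0)"
  unfolding P_NC_def
proof (rule pmf_embed_pmf)
  have nn: "weight w n E \<ge> 0" if "E \<in> NC n" for E
    unfolding weight_def by (intro prod_nonneg) (use that assms degree_NC_ge_1 in auto)
  then show "0 \<le> (if E \<in> NC n then weight w n E / Z w n else 0)" for E
    using assms(3) by simp
  have "(\<integral>\<^sup>+E. ennreal (if E \<in> NC n then weight w n E / Z w n else 0) \<partial>count_space UNIV)
      = (\<Sum>E\<in>NC n. ennreal (weight w n E / Z w n))"
    by (subst nn_integral_count_space'[of "NC n"]) (auto simp: finite_NC)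
  also have "\<dots> = ennreal (\<Sum>E\<in>NC n. weight w n E / Z w n)"
    by (rule sum_ennreal) (use nn assms(3) in auto)
  also have "(\<Sum>E\<in>NC n. weight w n E / Z w n) = 1"
    using assms(3) by (simp add: sum_divide_distrib[symmetric] Z_def)
  finally show "(\<integral>\<^sup>+E. ennreal (if E \<in> NC n then weight w n E / Z w n else 0) \<partial>count_space UNIV) = 1"
    by simp
qed

text \<open>
  \<open>gw_mass \<mu> \<tau>\<close> is the product of \<open>\<mu>(k\<^sub>u)\<close> over all vertices \<open>u\<close> of \<open>\<tau>\<close>, and in \<open>bgw_mass \<mu>0 \<mu> \<tau>\<close> the
  factor of the root is replaced by \<open>\<mu>0(k)\<close>.
\<close>

primrec gw_mass :: "nat pmf \<Rightarrow> plane_tree \<Rightarrow> real" where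
  "gw_mass \<mu> (PNode ts) = pmf \<mu> (length ts) * prod_list (map (gw_mass \<mu>) ts)"

definition bgw_mass :: "nat pmf \<Rightarrow> nat pmf \<Rightarrow> plane_tree \<Rightarrow> real" where
  "bgw_mass \<mu>0 \<mu> \<tau> =
     pmf \<mu>0 (length (subtrees \<tau>)) * prod_list (map (gw_mass \<mu>) (subtrees \<tau>))"

text \<open>
  The type \<open>plane_tree\<close> only contains finite trees; the event that the tree is infinite, which may
  have positive probability, is represented by the missing mass of the subprobability.
\<close>

definition BGW :: "nat pmf \<Rightarrow> nat pmf \<Rightarrow> plane_tree spmf" where
  "BGW \<mu>0 \<mu> = embed_spmf (bgw_mass \<mu>0 \<mu>)"

text \<open>
  The masses \<^term>\<open>bgw_mass \<mu>0 \<mu>\<close> do form a subprobability: they are the increasing limits of the laws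
  \<open>bgw_upto h\<close> of the tree discarded when it has more than \<open>h + 1\<close> generations.
\<close>

definition graft :: "plane_tree option list \<Rightarrow> plane_tree option" where
  "graft xs = (if None \<in> set xs then None else Some (PNode (map the xs)))"

primrec gw_upto :: "nat pmf \<Rightarrow> nat \<Rightarrow> plane_tree option pmf" where
  "gw_upto \<mu> 0 = return_pmf None"
| "gw_upto \<mu> (Suc h) = bind_pmf \<mu> (\<lambda>k. map_pmf graft (replicate_pmf k (gw_upto \<mu> h)))"

definition bgw_upto :: "nat pmf \<Rightarrow> nat pmf \<Rightarrow> nat \<Rightarrow> plane_tree option pmf" where
  "bgw_upto \<mu>0 \<mu> h = bind_pmf \<mu>0 (\<lambda>k. map_pmf graft (replicate_pmf k (gw_upto \<mu> h)))"

primrec generations :: "plane_tree \<Rightarrow> nat" where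
  "generations (PNode ts) = Suc (Max (insert 0 (set (map generations ts))))"

lemma pmf_replicate_pmf:
  "pmf (replicate_pmf k p) xs = (if length xs = k then prod_list (map (pmf p) xs) else 0)"
proof (induction k arbitrary: xs)
  case 0
  then show ?case by (auto simp: indicator_def)
next
  case (Suc k)
  show ?case
  proof (cases xs)
    case Nil
    have "[] \<notin> set_pmf (replicate_pmf (Suc k) p)"
      by (auto simp: set_replicate_pmf simp del: replicate_pmf.simps)
    then show ?thesis using Nil by (simp add: pmf_eq_0_set_pmf del: replicate_pmf.simps)
  next
    case (Cons y ys)
    have "replicate_pmf (Suc k) p = map_pmf (\<lambda>(x, xs). x # xs) (pair_pmf p (replicate_pmf k p))"
      by (simp add: pair_pmf_def map_bind_pmf map_return_pmf)
    moreover have "inj (\<lambda>(x, xs). x # xs)" by (auto simp: inj_def)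
    ultimately have "pmf (replicate_pmf (Suc k) p) (y # ys) = pmf p y * pmf (replicate_pmf k p) ys"
      using pmf_map_inj'[of "\<lambda>(x, xs). x # xs" "pair_pmf p (replicate_pmf k p)" "(y, ys)"]
      by (simp add: pmf_pair del: replicate_pmf.simps)
    then show ?thesis using Cons Suc.IH by (simp del: replicate_pmf.simps)
  qed
qed

lemma pmf_graft:
  "pmf (bind_pmf \<nu> (\<lambda>k. map_pmf graft (replicate_pmf k p))) (Some (PNode ts)) =
     pmf \<nu> (length ts) * prod_list (map (\<lambda>t. pmf p (Some t)) ts)"
proof -
  have pre: "graft -` {Some (PNode ts)} = {map Some ts}"
  proof (intro equalityI subsetI)
    fix xs assume "xs \<in> graft -` {Some (PNode ts)}"
    then have "None \<notin> set xs" "map the xs = ts" by (auto simp: graft_def split: if_splits)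
    then have "xs = map Some ts" by (induction xs arbitrary: ts) auto
    then show "xs \<in> {map Some ts}" by simp
  qed (auto simp: graft_def o_def)
  have "pmf (map_pmf graft (replicate_pmf k p)) (Some (PNode ts)) =
      indicator {length ts} k * prod_list (map (\<lambda>t. pmf p (Some t)) ts)" for k
    by (simp add: pmf_map pre measure_pmf_single pmf_replicate_pmf o_def indicator_def)
  then show ?thesis
    by (simp add: pmf_bind measure_pmf_single)
qed

lemma generations_le_Suc:
  "generations (PNode ts) \<le> Suc h \<longleftrightarrow> (\<forall>t\<in>set ts. generations t \<le> h)"
  by auto

lemma prod_list_if:
  fixes f :: "'a \<Rightarrow> real"
  shows "prod_list (map (\<lambda>x. if P x then f x else 0) xs) =
    (if \<forall>x\<in>set xs. P x then prod_list (map f xs) else 0)"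
  by (induction xs) auto

lemma pmf_gw_upto:
  "pmf (gw_upto \<mu> h) (Some t) = (if generations t \<le> h then gw_mass \<mu> t else 0)"
proof (induction h arbitrary: t)
  case 0
  then show ?case by (cases t) simp
next
  case (Suc h)
  obtain ts where t: "t = PNode ts" by (cases t)
  show ?case
    unfolding t gw_upto.simps pmf_graft Suc.IH prod_list_if generations_le_Suc by simp
qed

lemma pmf_bgw_upto:
  "pmf (bgw_upto \<mu>0 \<mu> h) (Some t) = (if generations t \<le> Suc h then bgw_mass \<mu>0 \<mu> t else 0)"
proof -
  obtain ts where t: "t = PNode ts" by (cases t)
  show ?thesis
    unfolding t bgw_upto_def pmf_graft pmf_gw_upto prod_list_if generations_le_Suc
    by (simp add: bgw_mass_def)
qed

lemma bgw_mass_nonneg: "0 \<le> bgw_mass \<mu>0 \<mu> t"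
  using pmf_nonneg[of "bgw_upto \<mu>0 \<mu> (generations t)" "Some t"] by (simp add: pmf_bgw_upto)

lemma nn_integral_bgw_mass_le_1:
  "(\<integral>\<^sup>+t. ennreal (bgw_mass \<mu>0 \<mu> t) \<partial>count_space UNIV) \<le> 1"
proof -
  let ?f = "\<lambda>h t. ennreal (spmf (bgw_upto \<mu>0 \<mu> h) t)"
  have sup: "ennreal (bgw_mass \<mu>0 \<mu> t) = (SUP h. ?f h t)" for t
  proof (rule antisym)
    have "ennreal (bgw_mass \<mu>0 \<mu> t) = ?f (generations t) t" by (simp add: pmf_bgw_upto)
    also have "\<dots> \<le> (SUP h. ?f h t)" by (rule SUP_upper) simp
    finally show "ennreal (bgw_mass \<mu>0 \<mu> t) \<le> (SUP h. ?f h t)" .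
    show "(SUP h. ?f h t) \<le> ennreal (bgw_mass \<mu>0 \<mu> t)"
      by (rule SUP_least) (simp add: pmf_bgw_upto)
  qed
  have "incseq ?f"
    by (auto simp: incseq_def le_fun_def pmf_bgw_upto bgw_mass_nonneg)
  then have "(\<integral>\<^sup>+t. (SUP h. ?f h t) \<partial>count_space UNIV) = (SUP h. \<integral>\<^sup>+t. ?f h t \<partial>count_space UNIV)"
    by (intro nn_integral_monotone_convergence_SUP) simp_all
  also have "\<dots> \<le> 1"
    by (rule SUP_least)
      (simp add: nn_integral_spmf measure_spmf.emeasure_eq_measure measure_spmf.subprob_measure_le_1)
  finally show ?thesis unfolding sup .
qed

lemma spmf_BGW: "spmf (BGW \<mu>0 \<mu>) t = bgw_mass \<mu>0 \<mu> t"
  unfolding BGW_def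
  by (simp add: spmf_embed_spmf[OF nn_integral_bgw_mass_le_1] bgw_mass_nonneg)

definition BGW_n :: "nat \<Rightarrow> nat pmf \<Rightarrow> nat pmf \<Rightarrow> plane_tree spmf" where
  "BGW_n n \<mu>0 \<mu> = cond_spmf (BGW \<mu>0 \<mu>) {\<tau>. num_vertices \<tau> = n}"

end

theory Submission
  imports Defs
begin

text \<open>
  The children of a non-root vertex \<open>u\<close> of a noncrossing tree have labels smaller or larger than
  that of \<open>u\<close>, and the edge from \<open>u\<close> to its parent makes the subtrees of the children occupy
  consecutive intervals of labels. The tree is therefore determined by its shape together with
  the number of smaller children of each non-root vertex, which can be any of \<open>0, \<dots>, k\<^sub>u\<close>. So
  a shape \<open>\<tau>\<close> is carried by \<open>\<Prod>(k\<^sub>u + 1)\<close> noncrossing trees (product over the non-root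
  vertices), each of weight \<open>w(k) \<Prod>w(k\<^sub>u + 1)\<close> with \<open>k\<close> the degree of the root. On the trees with
  \<open>n\<close> vertices, the tilting by \<open>a\<close>, \<open>b\<close> and \<open>c\<close> only contributes the constant \<open>c (a b)\<^sup>n\<^sup>-\<^sup>1\<close>,
  which disappears in the conditioning.
\<close>

section \<open>Crossing chords\<close>

text \<open>Geometry enters only to replace crossing chords by interleaving labels; after that the
  objects are edge sets. The description by shape and left counts is made recursive by keeping apart
  the left and right descendants of every non-root vertex: each group, like the remaining children
  of the parent, is again an interval of labels next to one outside vertex. This gives ternary
  trees, along which edges, shape and degrees are computed structurally. The hard half is that every
  noncrossing tree arises so: deleting the outside vertex leaves components that are intervals, each
  with exactly one neighbour of that vertex, and no edge passes over this neighbour. The exponent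
  \<open>n - 1\<close> appears twice: the child counts of all vertices sum to it, and it is the
  number of non-root vertices, each bringing one \<open>a\<close>. Positivity of
  \<open>Z w n\<close> yields some \<open>w k > 0\<close> with \<open>k \<ge> 1\<close>, so neither
  series vanishes, and \<open>b < \<rho>\<close> makes both converge; hence both offspring laws have
  mass 1.\<close>

text \<open>The rotation brings the midpoint of the arc from \<open>p\<close> to \<open>q\<close> to
  1 and makes the chord vertical; the value is the signed distance of \<open>z\<close> to the
  chord's line, so it is affine in \<open>z\<close>.\<close>

definition chord_side :: "nat \<Rightarrow> nat \<Rightarrow> nat \<Rightarrow> complex \<Rightarrow> real" where
  "chord_side n p q z = Re (z * cis (pi * (real p + real q) / n)) - cos (pi * (real q - real p) / n)"

lemma vertex_cis: "vertex n p = cis (- (2 * pi * p / n))"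
  unfolding vertex_def cis_conv_exp by (rule arg_cong[where f=exp]) simp

lemma vertex_rotate: "vertex n r * cis (pi * (real p + real q) / n) = cis (pi * (real p + real q - 2 * real r) / n)"
  unfolding vertex_cis cis_mult by (rule arg_cong[where f=cis]) (simp add: diff_divide_distrib algebra_simps)

lemma chord_side_vertex:
  "chord_side n p q (vertex n r) =
     cos (pi * (real p + real q - 2 * real r) / n) - cos (pi * (real q - real p) / n)"
  unfolding chord_side_def vertex_rotate by simp

lemma cos_less_cos_scaled:
  fixes x y :: real
  assumes "n > 0" "0 \<le> x" "x < y" "y \<le> n"
  shows "cos (pi * y / n) < cos (pi * x / n)"
proof (rule cos_monotone_0_pi)
  have "y / n \<le> 1" using assms by simp
  then have "pi * (y / n) \<le> pi * 1" by (intro mult_left_mono) auto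
  then show "pi * y / n \<le> pi" by simp
qed (use assms in \<open>auto simp: divide_strict_right_mono\<close>)

text \<open>Here \<open>p + q - 2 * r\<close> has absolute value less than \<open>q - p\<close>, and
  cosine decreases on [0, pi].\<close>

lemma chord_side_inside:
  assumes "p < r" "r < q" "q < n"
  shows "chord_side n p q (vertex n r) > 0"
proof -
  have "cos (pi * (real q - real p) / n) < cos (pi * \<bar>real p + real q - 2 * real r\<bar> / n)"
    using assms by (intro cos_less_cos_scaled) linarith+
  also have "pi * \<bar>real p + real q - 2 * real r\<bar> / n = \<bar>pi * (real p + real q - 2 * real r) / n\<bar>"
    by (simp add: abs_mult)
  finally show ?thesis unfolding chord_side_vertex cos_abs_real by simp
qed

lemma chord_side_outside:
  assumes "p < q" "q < n" "r < p \<or> q < r" "r < n"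
  shows "chord_side n p q (vertex n r) < 0"
proof -
  define x where "x = \<bar>real p + real q - 2 * real r\<bar>"
  have n: "real n > 0" using assms by simp
  have x: "real q - real p < x" "x < 2 * real n - (real q - real p)" "0 < real q - real p" "real q - real p < n"
    using assms unfolding x_def by linarith+
  have "cos (pi * x / n) < cos (pi * (real q - real p) / n)"
  proof (cases "x \<le> n")
    case True
    then show ?thesis using x by (intro cos_less_cos_scaled) linarith+
  next
    \<comment> \<open>Beyond pi cosine increases again; reflecting the angle at pi brings it back to
      the decreasing range.\<close>
    case False
    have "cos (pi * x / n) = cos (2 * pi - pi * x / n)"
      by (metis cos_2pi_minus)
    also have "2 * pi - pi * x / n = pi * (2 * real n - x) / n"
      using n by (simp add: field_simps)
    also have "cos \<dots> < cos (pi * (real q - real p) / n)"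
      using x False by (intro cos_less_cos_scaled) linarith+
    finally show ?thesis .
  qed
  moreover have "pi * x / n = \<bar>pi * (real p + real q - 2 * real r) / n\<bar>"
    by (simp add: x_def abs_mult)
  ultimately show ?thesis unfolding chord_side_vertex by (metis cos_abs_real diff_less_0_iff_less)
qed

lemma chord_side_endpoint: "chord_side n p q (vertex n p) = 0" "chord_side n p q (vertex n q) = 0"
proof -
  show "chord_side n p q (vertex n p) = 0" by (simp add: chord_side_vertex algebra_simps)
  have "pi * (real p + real q - 2 * real q) / n = - (pi * (real q - real p) / n)"
    by (simp add: diff_divide_distrib algebra_simps)
  then show "chord_side n p q (vertex n q) = 0" unfolding chord_side_vertex by (simp only: cos_minus)
qed

lemma chord_side_convex:
  "chord_side n p q ((1 - t) *\<^sub>R x + t *\<^sub>R y) = (1 - t) * chord_side n p q x + t * chord_side n p q y"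
  by (simp add: chord_side_def algebra_simps)

lemma norm_vertex: "norm (vertex n p) = 1"
  by (simp add: vertex_cis)

text \<open>On the chord's line, the unit disk cuts out exactly the chord.\<close>

lemma mem_chord:
  assumes "p < q" "q < n" "norm z \<le> 1" "chord_side n p q z = 0"
  shows "z \<in> closed_segment (vertex n p) (vertex n q)"
proof -
  define m where "m = pi * (real p + real q) / n"
  define d where "d = pi * (real q - real p) / n"
  have "(real q - real p) / n < 1" using assms by simp
  then have "pi * ((real q - real p) / n) < pi * 1" by (intro mult_strict_left_mono) auto
  then have "0 < d" "d < pi" using assms by (auto simp: d_def)
  then have s: "sin d > 0" by (rule sin_gt_zero)
  have Re: "Re (z * cis m) = cos d" using assms(4) by (simp add: chord_side_def m_def d_def)
  define y where "y = Im (z * cis m)"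
  have "norm (z * cis m) \<le> 1" using assms(3) by (simp add: norm_mult)
  then have "(cos d)\<^sup>2 + y\<^sup>2 \<le> 1"
    unfolding cmod_def Re y_def[symmetric] by simp
  then have "y\<^sup>2 \<le> (sin d)\<^sup>2" using sin_cos_squared_add[of d] by linarith
  then have y: "\<bar>y\<bar> \<le> sin d" using s by (metis abs_le_square_iff abs_of_pos)
  \<comment> \<open>Rotated, the endpoints are \<open>cis d\<close> and \<open>cis (- d)\<close>, at
    heights \<open>sin d\<close> and \<open>- sin d\<close>; \<open>t\<close> solves
    \<open>(1 - t) * sin d - t * sin d = y\<close>.\<close>
  define t where "t = (sin d - y) / (2 * sin d)"
  have t: "0 \<le> t" "t \<le> 1" using y s by (auto simp: t_def field_simps)
  have ty: "(1 - t) * sin d - t * sin d = y" using s by (simp add: t_def field_simps)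
  have vp: "vertex n p * cis m = cis d" unfolding m_def vertex_rotate d_def by simp
  have vq: "vertex n q * cis m = cis (- d)" unfolding m_def vertex_rotate d_def
    by (rule arg_cong[where f=cis]) (simp add: diff_divide_distrib algebra_simps)
  have "((1 - t) *\<^sub>R vertex n p + t *\<^sub>R vertex n q) * cis m = (1 - t) *\<^sub>R cis d + t *\<^sub>R cis (- d)"
    unfolding vp[symmetric] vq[symmetric] by (simp add: algebra_simps)
  also have "\<dots> = z * cis m"
  proof (rule complex_eqI)
    show "Re ((1 - t) *\<^sub>R cis d + t *\<^sub>R cis (- d)) = Re (z * cis m)"
      unfolding Re by (simp add: algebra_simps)
    show "Im ((1 - t) *\<^sub>R cis d + t *\<^sub>R cis (- d)) = Im (z * cis m)"
      using ty unfolding y_def[symmetric] by simp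
  qed
  finally have "z = (1 - t) *\<^sub>R vertex n p + t *\<^sub>R vertex n q" by simp
  then show ?thesis using t by (auto simp: closed_segment_def)
qed

text \<open>Along the second segment \<open>chord_side n p q\<close> changes sign, so it vanishes at
  some point; that point is in the disk, hence on the chord by \<open>mem_chord\<close>.\<close>

lemma chords_cross:
  assumes "p < r" "r < q" "q < s" "s < n"
  shows "closed_segment (vertex n p) (vertex n q) \<inter> closed_segment (vertex n r) (vertex n s) \<noteq> {}"
proof -
  let ?f = "chord_side n p q"
  define x where "x = ?f (vertex n r)"
  define y where "y = ?f (vertex n s)"
  have xy: "x > 0" "y < 0"
    using assms chord_side_inside[of p r q n] chord_side_outside[of p q n s] by (auto simp: x_def y_def)
  define t where "t = x / (x - y)"
  have t: "0 \<le> t" "t \<le> 1" using xy by (auto simp: t_def)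
  define z where "z = (1 - t) *\<^sub>R vertex n r + t *\<^sub>R vertex n s"
  have z: "z \<in> closed_segment (vertex n r) (vertex n s)"
    using t by (auto simp: z_def closed_segment_def)
  have "norm z \<le> 1"
  proof -
    have "closed_segment (vertex n r) (vertex n s) \<subseteq> cball 0 1"
      by (intro closed_segment_subset) (auto simp: norm_vertex)
    then show ?thesis using z by auto
  qed
  moreover have "?f z = 0"
    unfolding z_def chord_side_convex x_def[symmetric] y_def[symmetric]
    using xy by (simp add: t_def field_simps)
  ultimately have "z \<in> closed_segment (vertex n p) (vertex n q)"
    using assms by (intro mem_chord) auto
  then show ?thesis using z by blast
qed

text \<open>By \<open>side\<close>, \<open>chord_side n p q\<close> has the same weak sign at
  \<open>r\<close> and \<open>s\<close>. If a convex combination of the two values vanishes, both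
  terms do, so a common point is an end of the second segment that is also \<open>p\<close> or
  \<open>q\<close>.\<close>

lemma chords_meet_at_endpoint:
  assumes pq: "p < q" "q < n" and rs: "r < s" "s < n" and ne: "{p, q} \<noteq> {r, s}"
    and side: "p \<le> r \<and> s \<le> q \<or> (r \<le> p \<or> q \<le> r) \<and> (s \<le> p \<or> q \<le> s)"
  shows "closed_segment (vertex n p) (vertex n q) \<inter> closed_segment (vertex n r) (vertex n s)
          \<subseteq> vertex n ` ({p, q} \<inter> {r, s})"
proof
  let ?f = "chord_side n p q"
  fix z assume z: "z \<in> closed_segment (vertex n p) (vertex n q) \<inter> closed_segment (vertex n r) (vertex n s)"
  then obtain t where "z = (1 - t) *\<^sub>R vertex n p + t *\<^sub>R vertex n q" by (auto simp: closed_segment_def)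
  then have z0: "?f z = 0" by (simp add: chord_side_convex chord_side_endpoint)
  obtain u where u: "0 \<le> u" "u \<le> 1" "z = (1 - u) *\<^sub>R vertex n r + u *\<^sub>R vertex n s"
    using z by (auto simp: closed_segment_def)
  have sum: "(1 - u) * ?f (vertex n r) + u * ?f (vertex n s) = 0"
    using z0 u(3) by (simp add: chord_side_convex)
  have zero: "?f (vertex n x) = 0 \<longleftrightarrow> x \<in> {p, q}" if "x < n" for x
    using chord_side_inside[of p x q n] chord_side_outside[of p q n x] pq that
    by (auto simp: chord_side_endpoint not_less_iff_gr_or_eq) (meson less_irrefl linorder_neqE_nat)
  have "(?f (vertex n r) \<ge> 0 \<and> ?f (vertex n s) \<ge> 0) \<or> (?f (vertex n r) \<le> 0 \<and> ?f (vertex n s) \<le> 0)"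
  proof -
    have pos: "?f (vertex n x) \<ge> 0" if "p \<le> x" "x \<le> q" for x
      using that pq chord_side_inside[of p x q n] chord_side_endpoint[of n p q]
      by (cases "x = p \<or> x = q") (auto simp: less_imp_le)
    have neg: "?f (vertex n x) \<le> 0" if "x \<le> p \<or> q \<le> x" "x < n" for x
      using that pq chord_side_outside[of p q n x] chord_side_endpoint[of n p q]
      by (cases "x = p \<or> x = q") (auto simp: less_imp_le)
    show ?thesis using side pos[of r] pos[of s] neg[of r] neg[of s] rs by auto
  qed
  then have "(1 - u) * ?f (vertex n r) = 0 \<and> u * ?f (vertex n s) = 0"
  proof
    assume "?f (vertex n r) \<ge> 0 \<and> ?f (vertex n s) \<ge> 0"
    then have "(1 - u) * ?f (vertex n r) \<ge> 0" "u * ?f (vertex n s) \<ge> 0" using u by auto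
    then show ?thesis using sum by linarith
  next
    assume "?f (vertex n r) \<le> 0 \<and> ?f (vertex n s) \<le> 0"
    then have "(1 - u) * ?f (vertex n r) \<le> 0" "u * ?f (vertex n s) \<le> 0"
      using u by (auto simp: mult_nonneg_nonpos)
    then show ?thesis using sum by linarith
  qed
  then have c: "u = 1 \<or> r \<in> {p, q}" "u = 0 \<or> s \<in> {p, q}"
    using zero[of r] zero[of s] rs by auto
  have "\<not> (r \<in> {p, q} \<and> s \<in> {p, q})" using ne rs by auto
  then have "u = 1 \<and> s \<in> {p, q} \<or> u = 0 \<and> r \<in> {p, q}" using c by auto
  then show "z \<in> vertex n ` ({p, q} \<inter> {r, s})" using u(3) by auto
qed

section \<open>From crossing segments to interleaving labels\<close>

text \<open>Edges are unordered and the four labels are arbitrary, so this one order pattern covers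
  every way in which two chords interleave.\<close>

definition crossfree :: "nat set set \<Rightarrow> bool" where
  "crossfree E \<longleftrightarrow> (\<forall>p q r s. {p, q} \<in> E \<longrightarrow> {r, s} \<in> E \<longrightarrow> \<not> (p < r \<and> r < q \<and> q < s))"

lemma noncrossing_iff_crossfree:
  assumes E: "E \<subseteq> {{u, v} | u v. u \<in> {..<n} \<and> v \<in> {..<n} \<and> u \<noteq> v}"
  shows "noncrossing n E \<longleftrightarrow> crossfree E"
proof
  have bd: "p < n" "q < n" "p \<noteq> q" if "{p, q} \<in> E" for p q
    using that E by (auto simp: doubleton_eq_iff subset_iff)
  {
    assume nc: "noncrossing n E"
    show "crossfree E"
      unfolding crossfree_def
    proof (intro allI impI notI)
      fix p q r s assume e: "{p, q} \<in> E" "{r, s} \<in> E" and c: "p < r \<and> r < q \<and> q < s"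
      then have "{p, q} \<noteq> {r, s}" "{p, q} \<inter> {r, s} = {}" by (auto simp: doubleton_eq_iff)
      then show False
        using nc e chords_cross[of p r q s n] c bd[of r s] unfolding noncrossing_def
        by (metis image_empty subset_empty)
    qed
  }
  assume cf: "crossfree E"
  have main: "closed_segment (vertex n p) (vertex n q) \<inter> closed_segment (vertex n r) (vertex n s)
      \<subseteq> vertex n ` ({p, q} \<inter> {r, s})"
    if e: "{p, q} \<in> E" "{r, s} \<in> E" "{p, q} \<noteq> {r, s}" and o: "p < q" "r < s" for p q r s
  proof (rule chords_meet_at_endpoint)
    show "p \<le> r \<and> s \<le> q \<or> (r \<le> p \<or> q \<le> r) \<and> (s \<le> p \<or> q \<le> s)"
    proof -
      have "\<not> (p < r \<and> r < q \<and> q < s)" "\<not> (r < p \<and> p < s \<and> s < q)"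
        using cf e(1,2) unfolding crossfree_def by blast+
      then show ?thesis using o by linarith
    qed
  qed (use bd e o in auto)
  show "noncrossing n E"
    unfolding noncrossing_def
  proof (intro allI impI)
    fix p q r s assume e: "{p, q} \<in> E" "{r, s} \<in> E" "{p, q} \<noteq> {r, s}"
    consider "p < q" "r < s" | "p < q" "s < r" | "q < p" "r < s" | "q < p" "s < r"
      using bd[OF e(1)] bd[OF e(2)] by linarith
    then show "closed_segment (vertex n p) (vertex n q) \<inter> closed_segment (vertex n r) (vertex n s)
      \<subseteq> vertex n ` ({p, q} \<inter> {r, s})"
      using e main[of p q r s] main[of q p r s] main[of p q s r] main[of q p s r]
      by cases (simp_all add: insert_commute closed_segment_commute)
  qed
qed

section \<open>Noncrossing trees as ternary trees\<close>

text \<open>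
  A forest \<open>t\<close> encodes a noncrossing tree on a vertex \<open>u\<close> and the interval of labels
  \<open>{l..<l + size t}\<close>, where \<open>u\<close> lies outside of the interval, on either side. In \<open>Hang L R F\<close>,
  the first child \<open>c\<close> of \<open>u\<close> carries \<open>L\<close> on its left and \<open>R\<close> on its right, and \<open>F\<close> describes
  the other children of \<open>u\<close>. An edge between \<open>u\<close> and \<open>c\<close> prevents the descendants of \<open>c\<close> from being
  joined over \<open>c\<close>, which is why they split into these two groups.
\<close>

datatype forest = Void | Hang forest forest forest

primrec fedges :: "forest \<Rightarrow> nat \<Rightarrow> nat \<Rightarrow> nat set set" where
  "fedges Void u l = {}"
| "fedges (Hang L R F) u l = insert {u, l + size L}
     (fedges L (l + size L) l \<union> fedges R (l + size L) (Suc (l + size L)) \<union>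
      fedges F u (Suc (l + size L + size R)))"

primrec shapes :: "forest \<Rightarrow> plane_tree list" where
  "shapes Void = []"
| "shapes (Hang L R F) = PNode (shapes L @ shapes R) # shapes F"

primrec roots :: "forest \<Rightarrow> nat \<Rightarrow> nat list" where
  "roots Void l = []"
| "roots (Hang L R F) l = (l + size L) # roots F (Suc (l + size L + size R))"

text \<open>Orients each edge from a label to the vertex one step nearer to \<open>u\<close>;
  together with \<open>depth\<close> this rules out cycles.\<close>

primrec parent :: "forest \<Rightarrow> nat \<Rightarrow> nat \<Rightarrow> nat \<Rightarrow> nat" where
  "parent Void u l x = u"
| "parent (Hang L R F) u l x =
    (if x < l + size L then parent L (l + size L) l x
     else if x = l + size L then u
     else if x < Suc (l + size L + size R) then parent R (l + size L) (Suc (l + size L)) x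
     else parent F u (Suc (l + size L + size R)) x)"

primrec depth :: "forest \<Rightarrow> nat \<Rightarrow> nat \<Rightarrow> nat \<Rightarrow> nat" where
  "depth Void d l x = d"
| "depth (Hang L R F) d l x =
    (if x < l + size L then depth L (Suc d) l x
     else if x = l + size L then d
     else if x < Suc (l + size L + size R) then depth R (Suc d) (Suc (l + size L)) x
     else depth F d (Suc (l + size L + size R)) x)"

text \<open>\<open>size\<close> counts the \<open>Hang\<close> nodes, one for each vertex other than
  \<open>u\<close>.\<close>

abbreviation labels :: "forest \<Rightarrow> nat \<Rightarrow> nat set" where
  "labels t l \<equiv> {l..<l + size t}"

lemma labels_Hang:
  "labels (Hang L R F) l = insert (l + size L)
     (labels L l \<union> labels R (Suc (l + size L)) \<union> labels F (Suc (l + size L + size R)))"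
  by auto

section \<open>Encoded edge sets are noncrossing trees\<close>

lemma fedges_eq_parent: "fedges t u l = (\<lambda>x. {x, parent t u l x}) ` labels t l"
proof (induction t arbitrary: u l)
  case Void
  show ?case by simp
next
  case (Hang L R F)
  let ?p = "parent (Hang L R F) u l"
  have "(\<lambda>x. {x, ?p x}) ` labels L l = fedges L (l + size L) l"
    unfolding Hang.IH by (rule image_cong) auto
  moreover have "(\<lambda>x. {x, ?p x}) ` labels R (Suc (l + size L)) = fedges R (l + size L) (Suc (l + size L))"
    unfolding Hang.IH by (rule image_cong) auto
  moreover have "(\<lambda>x. {x, ?p x}) ` labels F (Suc (l + size L + size R))
      = fedges F u (Suc (l + size L + size R))"
    unfolding Hang.IH by (rule image_cong) auto
  moreover have "(\<lambda>x. {x, ?p x}) ` {l + size L} = {{u, l + size L}}"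
    by (simp add: insert_commute)
  ultimately show ?case
    unfolding labels_Hang image_insert image_Un fedges.simps by (auto simp: insert_commute)
qed

lemma depth_ge: "d \<le> depth t d l x"
proof (induction t arbitrary: d l)
  case (Hang L R F)
  show ?case
    using Hang.IH(1)[of "Suc d" l] Hang.IH(2)[of "Suc d" "Suc (l + size L)"]
      Hang.IH(3)[of d "Suc (l + size L + size R)"] by auto
qed simp

text \<open>Inside \<open>L\<close> and \<open>R\<close> the parent may be the child of
  \<open>u\<close> carrying them; its depth is \<open>d\<close>, while depths in \<open>L\<close>
  and \<open>R\<close> start at \<open>Suc d\<close>.\<close>

lemma parent_cases:
  assumes "x \<in> labels t l" "u \<notin> labels t l"
  shows "parent t u l x = u \<or> parent t u l x \<in> labels t l \<and> depth t d l (parent t u l x) < depth t d l x"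
  using assms
proof (induction t arbitrary: u d l)
  case Void
  then show ?case by simp
next
  case (Hang L R F)
  let ?c = "l + size L"
  consider "x \<in> labels L l" | "x = ?c" | "x \<in> labels R (Suc ?c)" | "x \<in> labels F (Suc (?c + size R))"
    using Hang.prems(1) unfolding labels_Hang by blast
  then show ?case
  proof cases
    case 1
    then show ?thesis using Hang.IH(1)[of l ?c "Suc d"] depth_ge[of "Suc d" L l x] by auto
  next
    case 3
    then show ?thesis
      using Hang.IH(2)[of "Suc ?c" ?c "Suc d"] depth_ge[of "Suc d" R "Suc ?c" x] by auto
  next
    case 4
    then show ?thesis using Hang.IH(3)[of "Suc (?c + size R)" u d] Hang.prems(2) by auto
  qed simp
qed

lemma fedges_subset: "e \<in> fedges t u l \<Longrightarrow> e \<subseteq> insert u (labels t l)"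
  by (induction t arbitrary: u l) fastforce+

lemma fedges_labels: "{x, y} \<in> fedges t u l \<Longrightarrow> x = u \<or> x \<in> labels t l"
  using fedges_subset by blast

lemma fedges_meets_labels: "e \<in> fedges t u l \<Longrightarrow> \<exists>x\<in>labels t l. x \<in> e"
  unfolding fedges_eq_parent by blast

lemma fedges_proper:
  assumes "u \<notin> labels t l" "{x, y} \<in> fedges t u l"
  shows "x \<noteq> y"
proof
  assume "x = y"
  then obtain z where z: "z \<in> labels t l" "{x} = {z, parent t u l z}"
    using assms(2) unfolding fedges_eq_parent by auto
  then have "parent t u l z = z" by auto
  then show False using parent_cases[OF z(1) assms(1), of 0] z(1) assms(1) by auto
qed

definition adj :: "'v set set \<Rightarrow> ('v \<times> 'v) set" where
  "adj E = {(x, y). {x, y} \<in> E}"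

lemma adj_iff [simp]: "(x, y) \<in> adj E \<longleftrightarrow> {x, y} \<in> E"
  by (simp add: adj_def)

lemma adj_mono: "E \<subseteq> E' \<Longrightarrow> (adj E)\<^sup>* \<subseteq> (adj E')\<^sup>*"
  by (rule rtrancl_mono) (auto simp: adj_def)

lemma adj_rtrancl_sym: "(x, y) \<in> (adj E)\<^sup>* \<Longrightarrow> (y, x) \<in> (adj E)\<^sup>*"
  by (rule symD[OF sym_rtrancl]) (auto simp: sym_def insert_commute)

lemma fedges_connected: "x \<in> insert u (labels t l) \<Longrightarrow> (x, u) \<in> (adj (fedges t u l))\<^sup>*"
proof (induction t arbitrary: u l)
  case Void
  then show ?case by simp
next
  case (Hang L R F)
  let ?E = "fedges (Hang L R F) u l"
  let ?c = "l + size L"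
  have cu: "(?c, u) \<in> (adj ?E)\<^sup>*" by (rule r_into_rtrancl) (simp add: insert_commute)
  consider "x \<in> labels L l" | "x = u" | "x = ?c" | "x \<in> labels R (Suc ?c)"
    | "x \<in> labels F (Suc (?c + size R))"
    using Hang.prems unfolding labels_Hang by blast
  then show ?case
  proof cases
    case 1
    then have "(x, ?c) \<in> (adj (fedges L ?c l))\<^sup>*" by (intro Hang.IH) simp
    also have "\<dots> \<subseteq> (adj ?E)\<^sup>*" by (rule adj_mono) auto
    finally show ?thesis using cu by simp
  next
    case 4
    then have "(x, ?c) \<in> (adj (fedges R ?c (Suc ?c)))\<^sup>*" by (intro Hang.IH) simp
    also have "\<dots> \<subseteq> (adj ?E)\<^sup>*" by (rule adj_mono) auto
    finally show ?thesis using cu by simp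
  next
    case 5
    then have "(x, u) \<in> (adj (fedges F u (Suc (?c + size R))))\<^sup>*" by (intro Hang.IH) simp
    also have "\<dots> \<subseteq> (adj ?E)\<^sup>*" by (rule adj_mono) auto
    finally show ?thesis .
  qed (use cu in simp_all)
qed

definition has_cycle :: "'v set set \<Rightarrow> bool" where
  "has_cycle E \<longleftrightarrow> (\<exists>cs. length cs \<ge> 3 \<and> distinct cs \<and>
           (\<forall>i<length cs. {cs ! i, cs ! (Suc i mod length cs)} \<in> E))"

text \<open>Both neighbours of the deepest vertex of a cycle would have to be its parent.\<close>

lemma ranked_acyclic:
  fixes rk :: "'v \<Rightarrow> nat"
  assumes "\<And>e. e \<in> E \<Longrightarrow> \<exists>x. e = {x, par x} \<and> rk (par x) < rk x"
  shows "\<not> has_cycle E"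
proof
  assume "has_cycle E"
  then obtain cs where cs: "length cs \<ge> 3" "distinct cs"
    "\<And>i. i < length cs \<Longrightarrow> {cs ! i, cs ! (Suc i mod length cs)} \<in> E"
    unfolding has_cycle_def by blast
  let ?n = "length cs"
  define M where "M = Max ((\<lambda>i. rk (cs ! i)) ` {..<?n})"
  have "M \<in> (\<lambda>i. rk (cs ! i)) ` {..<?n}"
    unfolding M_def using cs(1) by (intro Max_in) (auto simp: lessThan_empty_iff)
  then obtain i where i: "i < ?n" "M = rk (cs ! i)" by auto
  have max: "rk (cs ! j) \<le> rk (cs ! i)" if "j < ?n" for j
    using that unfolding i(2)[symmetric] M_def by auto
  have par: "cs ! j = par (cs ! i)" if "j < ?n" "{cs ! i, cs ! j} \<in> E" for j
    using assms[OF that(2)] max[OF that(1)] by (auto simp: doubleton_eq_iff)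
  \<comment> \<open>Cyclic successor and predecessor of \<open>i\<close>; they differ because the
    cycle has at least three vertices.\<close>
  define j where "j = Suc i mod ?n"
  define k where "k = (if i = 0 then ?n - 1 else i - 1)"
  have j: "j = (if Suc i = ?n then 0 else Suc i)" using i by (auto simp: j_def)
  have k: "k < ?n" "Suc k mod ?n = i" using i cs(1) by (auto simp: k_def)
  have "j < ?n" using i(1) unfolding j_def by (intro mod_less_divisor) linarith
  then have "cs ! j = par (cs ! i)" using cs(3)[OF i(1)] by (intro par) (simp_all add: j_def)
  moreover have "cs ! k = par (cs ! i)" using cs(3)[OF k(1)] k by (intro par) (auto simp: insert_commute)
  ultimately have "j = k" using cs(2) \<open>j < ?n\<close> k(1) by (metis distinct_conv_nth)
  then show False using j cs(1) i by (auto simp: k_def split: if_splits)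
qed

lemma fedges_acyclic:
  assumes u: "u \<notin> labels t l"
  shows "\<not> has_cycle (fedges t u l)"
proof (rule ranked_acyclic)
  fix e assume "e \<in> fedges t u l"
  then obtain x where x: "x \<in> labels t l" "e = {x, parent t u l x}"
    unfolding fedges_eq_parent by blast
  \<comment> \<open>The shift by one puts \<open>u\<close>, of rank 0, below every label.\<close>
  let ?rk = "\<lambda>x. if x \<in> labels t l then Suc (depth t 0 l x) else 0"
  have "?rk (parent t u l x) < ?rk x" using parent_cases[OF x(1) u, of 0] x(1) u by auto
  then show "\<exists>x. e = {x, parent t u l x} \<and> ?rk (parent t u l x) < ?rk x" using x(2) by blast
qed

text \<open>\<open>L\<close> with the child \<open>?c\<close> ends at \<open>?c\<close>,
  \<open>R\<close> with \<open>?c\<close> fills the labels from \<open>?c\<close> up to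
  \<open>?m\<close>, and \<open>F\<close> uses \<open>u\<close> and labels from \<open>?m\<close>
  on. As \<open>u\<close> is outside the interval, neither edges from different pieces nor the edge
  from \<open>u\<close> to \<open>?c\<close> can interleave with one another.\<close>

lemma crossfree_fedges: "u \<notin> labels t l \<Longrightarrow> crossfree (fedges t u l)"
proof (induction t arbitrary: u l)
  case Void
  then show ?case by (simp add: crossfree_def)
next
  case (Hang L R F)
  let ?c = "l + size L" and ?m = "Suc (l + size L + size R)"
  have IH: "crossfree (fedges L ?c l)" "crossfree (fedges R ?c (Suc ?c))" "crossfree (fedges F u ?m)"
    using Hang.prems by (auto intro!: Hang.IH)
  show ?case
    unfolding crossfree_def
  proof (intro allI impI notI)
    fix p q r s
    assume e: "{p, q} \<in> fedges (Hang L R F) u l" "{r, s} \<in> fedges (Hang L R F) u l"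
      and c: "p < r \<and> r < q \<and> q < s"
    have piece: "{x, y} = {u, ?c} \<or> {x, y} \<in> fedges L ?c l \<and> l \<le> x \<and> x \<le> ?c \<and> l \<le> y \<and> y \<le> ?c \<or>
        {x, y} \<in> fedges R ?c (Suc ?c) \<and> ?c \<le> x \<and> x < ?m \<and> ?c \<le> y \<and> y < ?m \<or>
        {x, y} \<in> fedges F u ?m \<and> (x = u \<or> ?m \<le> x \<and> x < ?m + size F) \<and> (y = u \<or> ?m \<le> y \<and> y < ?m + size F)"
      if xy: "{x, y} \<in> fedges (Hang L R F) u l" for x y
    proof -
      consider "{x, y} = {u, ?c}" | "{x, y} \<in> fedges L ?c l" | "{x, y} \<in> fedges R ?c (Suc ?c)"
        | "{x, y} \<in> fedges F u ?m"
        using xy unfolding fedges.simps by blast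
      then show ?thesis
      proof cases
        case 2
        moreover have "l \<le> x \<and> x \<le> ?c \<and> l \<le> y \<and> y \<le> ?c" using fedges_subset[OF 2] by auto
        ultimately show ?thesis by blast
      next
        case 3
        moreover have "?c \<le> x \<and> x < ?m \<and> ?c \<le> y \<and> y < ?m" using fedges_subset[OF 3] by auto
        ultimately show ?thesis by blast
      next
        case 4
        then show ?thesis using fedges_subset[OF 4] by simp
      qed simp
    qed
    have same: "\<not> ({p, q} \<in> G \<and> {r, s} \<in> G)" if "crossfree G" for G
      using that c unfolding crossfree_def by blast
    note same = same[OF IH(1)] same[OF IH(2)] same[OF IH(3)]
    have u: "u < l \<or> ?m + size F \<le> u" using Hang.prems by auto
    from piece[OF e(1)] show False
    proof (elim disjE)
      assume 1: "{p, q} = {u, ?c}"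
      from piece[OF e(2)] show False
        by (elim disjE conjE) (use 1 c u in \<open>auto simp: doubleton_eq_iff\<close>)
    next
      assume 1: "{p, q} \<in> fedges L ?c l \<and> l \<le> p \<and> p \<le> ?c \<and> l \<le> q \<and> q \<le> ?c"
      from piece[OF e(2)] show False
        by (elim disjE conjE) (use 1 c u same in \<open>auto simp: doubleton_eq_iff\<close>)
    next
      assume 1: "{p, q} \<in> fedges R ?c (Suc ?c) \<and> ?c \<le> p \<and> p < ?m \<and> ?c \<le> q \<and> q < ?m"
      from piece[OF e(2)] show False
        by (elim disjE conjE) (use 1 c u same in \<open>auto simp: doubleton_eq_iff\<close>)
    next
      assume 1: "{p, q} \<in> fedges F u ?m \<and>
        (p = u \<or> ?m \<le> p \<and> p < ?m + size F) \<and> (q = u \<or> ?m \<le> q \<and> q < ?m + size F)"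
      from piece[OF e(2)] show False
        by (elim disjE conjE) (use 1 c u same in \<open>auto simp: doubleton_eq_iff\<close>)
    qed
  qed
qed

lemma NC_iff:
  "E \<in> NC n \<longleftrightarrow> E \<subseteq> {{u, v} | u v. u \<in> {..<n} \<and> v \<in> {..<n} \<and> u \<noteq> v} \<and> 0 < n \<and>
     (\<forall>u<n. \<forall>v<n. (u, v) \<in> (adj E)\<^sup>*) \<and> \<not> has_cycle E \<and> crossfree E"
proof -
  have "is_tree {..<n} E \<longleftrightarrow> E \<subseteq> {{u, v} | u v. u \<in> {..<n} \<and> v \<in> {..<n} \<and> u \<noteq> v} \<and> 0 < n \<and>
     (\<forall>u<n. \<forall>v<n. (u, v) \<in> (adj E)\<^sup>*) \<and> \<not> has_cycle E"
    unfolding is_tree_def has_cycle_def[symmetric] adj_def[symmetric] lessThan_empty_iff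
    by (simp only: Ball_def lessThan_iff neq0_conv)
  then show ?thesis
    unfolding NC_def mem_Collect_eq using noncrossing_iff_crossfree[of E n] by argo
qed

lemma fedges_NC:
  assumes "n = Suc (size t)"
  shows "fedges t 0 1 \<in> NC n"
proof -
  have lab: "insert 0 (labels t 1) = {..<n}" using assms by auto
  have conn: "(u, 0) \<in> (adj (fedges t 0 1))\<^sup>*" if "u < n" for u
    using that lab by (intro fedges_connected) auto
  have "fedges t 0 1 \<subseteq> {{u, v} | u v. u \<in> {..<n} \<and> v \<in> {..<n} \<and> u \<noteq> v}"
  proof
    fix e assume e: "e \<in> fedges t 0 1"
    then obtain x y where xy: "e = {x, y}" unfolding fedges_eq_parent by blast
    then have "x \<noteq> y" using fedges_proper[of 0 1 t x y] e by auto
    moreover have "x \<in> {..<n}" "y \<in> {..<n}" using fedges_subset[OF e] unfolding lab xy by simp_all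
    ultimately show "e \<in> {{u, v} | u v. u \<in> {..<n} \<and> v \<in> {..<n} \<and> u \<noteq> v}" using xy by blast
  qed
  moreover have "(u, v) \<in> (adj (fedges t 0 1))\<^sup>*" if "u < n" "v < n" for u v
    using conn[OF that(1)] adj_rtrancl_sym[OF conn[OF that(2)]] by simp
  ultimately show ?thesis
    unfolding NC_iff using assms fedges_acyclic[of 0 1 t] crossfree_fedges[of 0 1 t] by simp
qed

section \<open>Shape and weight of an encoded tree\<close>

lemma set_roots: "set (roots t l) \<subseteq> labels t l"
  by (induction t arbitrary: l) fastforce+

lemma sorted_roots: "sorted_wrt (<) (roots t l)"
proof (induction t arbitrary: l)
  case (Hang L R F)
  have "l + size L < y" if "y \<in> set (roots F (Suc (l + size L + size R)))" for y
    using that set_roots[of F "Suc (l + size L + size R)"] by auto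
  then show ?case using Hang.IH(3) by simp
qed simp

lemma length_roots: "length (roots t l) = length (shapes t)"
  by (induction t arbitrary: l) auto

lemma fedges_root_iff:
  "u \<notin> labels t l \<Longrightarrow> {u, v} \<in> fedges t u l \<longleftrightarrow> v \<in> set (roots t l)"
proof (induction t arbitrary: l)
  case (Hang L R F)
  let ?c = "l + size L"
  have "{u, v} \<notin> fedges L ?c l" "{u, v} \<notin> fedges R ?c (Suc ?c)"
    using fedges_labels[of u v L ?c l] fedges_labels[of u v R ?c "Suc ?c"] Hang.prems by auto
  then show ?case using Hang by (auto simp: doubleton_eq_iff)
qed simp

text \<open>Edges at \<open>u\<close> that lead out of the interval are left free, since in the
  whole tree \<open>u\<close> may have other neighbours. So \<open>E\<close> can stay the full edge
  set while inductions descend into parts of the forest.\<close>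

definition agree :: "nat set set \<Rightarrow> forest \<Rightarrow> nat \<Rightarrow> nat \<Rightarrow> bool" where
  "agree E t u l \<longleftrightarrow> (\<forall>x\<in>labels t l. \<forall>v. {x, v} \<in> E \<longleftrightarrow> {x, v} \<in> fedges t u l)"

lemma agree_Hang:
  assumes E: "agree E (Hang L R F) u l" and u: "u \<notin> labels (Hang L R F) l"
  defines "c \<equiv> l + size L"
  shows "agree E L c l" "agree E R c (Suc c)" "agree E F u (Suc (c + size R))"
    "{v. {c, v} \<in> E} = insert u (set (roots L l @ roots R (Suc c)))"
proof -
  have lab: "labels (Hang L R F) l = insert c
     (labels L l \<union> labels R (Suc c) \<union> labels F (Suc (c + size R)))"
    unfolding labels_Hang c_def by simp
  note nL = fedges_labels[of _ _ L c l] and nR = fedges_labels[of _ _ R c "Suc c"]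
    and nF = fedges_labels[of _ _ F u "Suc (c + size R)"]
  have E': "{x, v} \<in> E \<longleftrightarrow> {x, v} = {u, c} \<or> {x, v} \<in> fedges L c l \<or> {x, v} \<in> fedges R c (Suc c) \<or>
      {x, v} \<in> fedges F u (Suc (c + size R))"
    if "x \<in> labels (Hang L R F) l" for x v
    using E that unfolding agree_def c_def by simp
  show "agree E L c l"
    unfolding agree_def
  proof (intro ballI allI)
    fix x v assume x: "x \<in> labels L l"
    show "{x, v} \<in> E \<longleftrightarrow> {x, v} \<in> fedges L c l"
      using E'[of x v] x u lab nR[of x v] nF[of x v]
      by (auto simp: doubleton_eq_iff c_def)
  qed
  show "agree E R c (Suc c)"
    unfolding agree_def
  proof (intro ballI allI)
    fix x v assume x: "x \<in> labels R (Suc c)"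
    show "{x, v} \<in> E \<longleftrightarrow> {x, v} \<in> fedges R c (Suc c)"
      using E'[of x v] x u lab nL[of x v] nF[of x v]
      by (auto simp: doubleton_eq_iff c_def)
  qed
  show "agree E F u (Suc (c + size R))"
    unfolding agree_def
  proof (intro ballI allI)
    fix x v assume x: "x \<in> labels F (Suc (c + size R))"
    show "{x, v} \<in> E \<longleftrightarrow> {x, v} \<in> fedges F u (Suc (c + size R))"
      using E'[of x v] x u lab nL[of x v] nR[of x v]
      by (auto simp: doubleton_eq_iff c_def)
  qed
  show "{v. {c, v} \<in> E} = insert u (set (roots L l @ roots R (Suc c)))"
  proof -
    have "{c, v} \<in> E \<longleftrightarrow> v = u \<or> v \<in> set (roots L l) \<or> v \<in> set (roots R (Suc c))" for v
      using E'[of c v] u lab nF[of c v] fedges_root_iff[of c l L v] fedges_root_iff[of c "Suc c" R v]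
      by (auto simp: doubleton_eq_iff c_def)
    then show ?thesis by auto
  qed
qed

lemma sorted_roots_append:
  "sorted_wrt (<) (roots L l @ roots R (Suc (l + size L)))"
  using set_roots[of L l] set_roots[of R "Suc (l + size L)"] sorted_roots
  by (fastforce simp: sorted_wrt_append)

text \<open>Once the parent is discarded, the neighbours of the first child by increasing label are
  the roots of \<open>L\<close> followed by those of \<open>R\<close>. The plane order thus forgets
  only where the split was.\<close>

lemma shapes_subtree_at:
  assumes "agree E t u l" "u \<notin> labels t l" "size t \<le> h"
  shows "map (subtree_at h E (Some u)) (roots t l) = shapes t"
  using assms
proof (induction t arbitrary: u l h)
  case (Hang L R F)
  let ?c = "l + size L"
  note ag = agree_Hang[OF Hang.prems(1,2)]
  obtain h' where h: "h = Suc h'" using Hang.prems(3) by (cases h) auto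
  have "set (roots L l @ roots R (Suc ?c)) \<subseteq> labels (Hang L R F) l"
    using set_roots[of L l] set_roots[of R "Suc ?c"] by fastforce
  then have "{v. {?c, v} \<in> E \<and> Some v \<noteq> Some u} = set (roots L l @ roots R (Suc ?c))"
    using ag(4) Hang.prems(2) by blast
  then have "children E (Some u) ?c = roots L l @ roots R (Suc ?c)"
    unfolding children_def using sorted_roots_append[of L l R]
    by (metis sorted_list_of_set.idem_if_sorted_distinct strict_sorted_iff)
  then have "subtree_at h E (Some u) ?c = PNode (shapes L @ shapes R)"
    unfolding h using Hang.IH(1)[OF ag(1), of h'] Hang.IH(2)[OF ag(2), of h'] Hang.prems(3) h by simp
  moreover have "map (subtree_at h E (Some u)) (roots F (Suc (?c + size R))) = shapes F"
    using Hang.prems by (intro Hang.IH(3)[OF ag(3)]) auto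
  ultimately show ?case by simp
qed simp

lemma shape_fedges:
  assumes "n = Suc (size t)"
  shows "shape n (fedges t 0 1) = PNode (shapes t)"
proof -
  have "{v. {0, v} \<in> fedges t 0 1 \<and> Some v \<noteq> None} = set (roots t 1)"
    using fedges_root_iff[of 0 1 t] by auto
  then have "children (fedges t 0 1) None 0 = roots t 1"
    unfolding children_def using sorted_roots[of t 1]
    by (metis sorted_list_of_set.idem_if_sorted_distinct strict_sorted_iff)
  then show ?thesis
    unfolding shape_def assms using shapes_subtree_at[of "fedges t 0 1" t 0 1 "size t"]
    by (simp add: agree_def)
qed

lemma degree_eq_card_nbrs:
  assumes "\<forall>e\<in>E. \<exists>x y. e = {x, y}" "\<forall>x. {x} \<notin> E"
  shows "degree E x = card {v. {x, v} \<in> E}"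
proof -
  have "bij_betw (\<lambda>v. {x, v}) {v. {x, v} \<in> E} {e \<in> E. x \<in> e}"
    unfolding bij_betw_def
  proof
    show "inj_on (\<lambda>v. {x, v}) {v. {x, v} \<in> E}" by (auto simp: inj_on_def doubleton_eq_iff)
    show "(\<lambda>v. {x, v}) ` {v. {x, v} \<in> E} = {e \<in> E. x \<in> e}"
      using assms(1) by (fastforce simp: insert_commute)
  qed
  then show ?thesis unfolding Defs.degree_def by (rule bij_betw_same_card[symmetric])
qed

text \<open>Weight of the vertices other than \<open>u\<close>; \<open>Suc\<close> accounts for the
  edge to the parent.\<close>

primrec fweight :: "(nat \<Rightarrow> real) \<Rightarrow> forest \<Rightarrow> real" where
  "fweight w Void = 1"
| "fweight w (Hang L R F) =
     w (Suc (length (shapes L) + length (shapes R))) * fweight w L * fweight w R * fweight w F"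

lemma prod_degree_fedges:
  assumes dbl: "\<forall>e\<in>E. \<exists>x y. e = {x, y}" "\<forall>x. {x} \<notin> E"
    and "agree E t u l" "u \<notin> labels t l"
  shows "(\<Prod>x\<in>labels t l. w (degree E x)) = fweight w t"
  using assms(3,4)
proof (induction t arbitrary: u l)
  case (Hang L R F)
  let ?c = "l + size L"
  note ag = agree_Hang[OF Hang.prems]
  have sub: "set (roots L l @ roots R (Suc ?c)) \<subseteq> labels (Hang L R F) l"
    using set_roots[of L l] set_roots[of R "Suc ?c"] by fastforce
  have "degree E ?c = card (insert u (set (roots L l @ roots R (Suc ?c))))"
    unfolding degree_eq_card_nbrs[OF dbl] ag(4) ..
  also have "\<dots> = Suc (card (set (roots L l @ roots R (Suc ?c))))"
    using sub Hang.prems(2) by (subst card_insert_disjoint) auto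
  also have "card (set (roots L l @ roots R (Suc ?c))) = length (roots L l @ roots R (Suc ?c))"
    using sorted_roots_append[of L l R] by (intro distinct_card) (metis strict_sorted_iff)
  finally have deg: "degree E ?c = Suc (length (shapes L) + length (shapes R))"
    by (simp add: length_roots)
  have "(\<Prod>x\<in>labels (Hang L R F) l. w (degree E x)) =
    w (degree E ?c) * ((\<Prod>x\<in>labels L l. w (degree E x)) * (\<Prod>x\<in>labels R (Suc ?c). w (degree E x)) *
     (\<Prod>x\<in>labels F (Suc (?c + size R)). w (degree E x)))"
    unfolding labels_Hang
    by (subst prod.insert, simp, simp, subst prod.union_disjoint, simp, simp, force,
        subst prod.union_disjoint, simp, simp, force, simp)
  moreover have "(\<Prod>x\<in>labels L l. w (degree E x)) = fweight w L"
    by (rule Hang.IH(1)[OF ag(1)]) simp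
  moreover have "(\<Prod>x\<in>labels R (Suc ?c). w (degree E x)) = fweight w R"
    by (rule Hang.IH(2)[OF ag(2)]) simp
  moreover have "(\<Prod>x\<in>labels F (Suc (?c + size R)). w (degree E x)) = fweight w F"
    by (rule Hang.IH(3)[OF ag(3)]) (use Hang.prems(2) in auto)
  ultimately show ?case unfolding deg fweight.simps by (simp only: mult.assoc)
qed simp

lemma weight_fedges:
  assumes n: "n = Suc (size t)"
  shows "weight w n (fedges t 0 1) = w (length (shapes t)) * fweight w t"
proof -
  let ?E = "fedges t 0 1"
  have dbl: "\<forall>e\<in>?E. \<exists>x y. e = {x, y}" unfolding fedges_eq_parent by blast
  have nl: "\<forall>x. {x} \<notin> ?E" using fedges_proper[of 0 1 t x x for x] by auto
  have "{v. {0, v} \<in> ?E} = set (roots t 1)" using fedges_root_iff[of 0 1 t] by auto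
  then have "degree ?E 0 = length (shapes t)"
    unfolding degree_eq_card_nbrs[OF dbl nl] length_roots[of t 1, symmetric]
    using sorted_roots[of t 1] by (simp add: distinct_card strict_sorted_iff)
  moreover have "(\<Prod>x\<in>labels t 1. w (degree ?E x)) = fweight w t"
    by (rule prod_degree_fedges[OF dbl nl]) (auto simp: agree_def)
  moreover have "{..<n} = insert 0 (labels t 1)" using n by auto
  ultimately show ?thesis unfolding weight_def by simp
qed

section \<open>Every noncrossing tree is encoded exactly once\<close>

lemma rtrancl_leaves:
  assumes "(x, y) \<in> R\<^sup>*" "P x" "\<not> P y"
  shows "\<exists>a b. (a, b) \<in> R \<and> P a \<and> \<not> P b"
  using assms by (induction rule: rtrancl_induct) auto

lemma rtrancl_simple_path:
  assumes "(x, y) \<in> r\<^sup>*"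
  shows "\<exists>xs. distinct xs \<and> xs \<noteq> [] \<and> hd xs = x \<and> last xs = y \<and> successively (\<lambda>a b. (a, b) \<in> r) xs"
  using assms
proof (induction rule: converse_rtrancl_induct)
  case base
  show ?case by (rule exI[of _ "[y]"]) simp
next
  case (step x x')
  then obtain xs where xs: "distinct xs" "xs \<noteq> []" "hd xs = x'" "last xs = y"
    "successively (\<lambda>a b. (a, b) \<in> r) xs" by blast
  show ?case
  proof (cases "x \<in> set xs")
    case False
    then show ?thesis using xs step by (intro exI[of _ "x # xs"]) (auto simp: successively_Cons)
  next
    case True
    then obtain ys zs where "xs = ys @ x # zs" by (auto simp: in_set_conv_decomp)
    then show ?thesis using xs by (intro exI[of _ "x # zs"]) (auto simp: successively_append_iff)
  qed
qed

text \<open>A simple path from \<open>x\<close> to \<open>y\<close> within \<open>B\<close> is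
  closed up through \<open>u\<close>; the cycle has length at least 3 because
  \<open>x \<noteq> y\<close>.\<close>

lemma two_edges_to_component_cycle:
  assumes "(x, y) \<in> (adj (E \<inter> Pow B))\<^sup>*" "x \<noteq> y" "u \<notin> B" "{u, x} \<in> E" "{u, y} \<in> E"
  shows "has_cycle E"
proof -
  obtain xs where xs: "distinct xs" "xs \<noteq> []" "hd xs = x" "last xs = y"
    "successively (\<lambda>a b. (a, b) \<in> adj (E \<inter> Pow B)) xs"
    using rtrancl_simple_path[OF assms(1)] by blast
  let ?cs = "u # xs"
  have len: "length xs \<ge> 2" using xs assms(2) by (cases xs; cases "tl xs") auto
  have succ: "{xs ! i, xs ! Suc i} \<in> E \<and> {xs ! i, xs ! Suc i} \<subseteq> B" if "Suc i < length xs" for i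
    using xs(5) that unfolding successively_conv_nth by auto
  have "set xs \<subseteq> B"
  proof
    fix z assume "z \<in> set xs"
    then obtain i where i: "i < length xs" "z = xs ! i" by (auto simp: in_set_conv_nth)
    show "z \<in> B"
    proof (cases "Suc i < length xs")
      case True
      then show ?thesis using succ i by blast
    next
      case False
      then obtain j where "i = Suc j" using len by (cases i) auto
      then show ?thesis using succ[of j] i by auto
    qed
  qed
  then have dist: "distinct ?cs" using xs(1) assms(3) by auto
  have "{?cs ! i, ?cs ! (Suc i mod length ?cs)} \<in> E" if i: "i < length ?cs" for i
  proof -
    consider "i = 0" | "i = length xs" "i \<noteq> 0" | j where "i = Suc j" "Suc j < length xs"
      using i by (cases i) fastforce+
    then show ?thesis
    proof cases
      case 1
      then show ?thesis using assms(4) xs(2,3) by (simp add: hd_conv_nth)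
    next
      case 2
      then have "?cs ! i = y" using xs(2,4) by (simp add: last_conv_nth nth_Cons')
      then show ?thesis using 2 assms(5) by (simp add: insert_commute)
    next
      case (3 j)
      then show ?thesis using succ by simp
    qed
  qed
  then show ?thesis unfolding has_cycle_def using dist len by (intro exI[of _ ?cs]) auto
qed

text \<open>A walk is cut at its first visit to \<open>c\<close>, before which it cannot leave
  \<open>T\<close>. This confines connectivity to smaller intervals.\<close>

lemma rtrancl_first_hit:
  assumes "(z, c) \<in> (adj (E \<inter> Pow S))\<^sup>*" "z \<in> T"
    and "\<And>x y. {x, y} \<in> E \<Longrightarrow> {x, y} \<subseteq> S \<Longrightarrow> x \<in> T \<Longrightarrow> y \<noteq> c \<Longrightarrow> y \<in> T"
  shows "(z, c) \<in> (adj (E \<inter> Pow (insert c T)))\<^sup>*"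
  using assms(1,2)
proof (induction rule: converse_rtrancl_induct)
  case base
  show ?case by simp
next
  case (step x y)
  show ?case
  proof (cases "y = c")
    case True
    then show ?thesis using step by (intro r_into_rtrancl) auto
  next
    case False
    then have "y \<in> T" using step assms(3)[of x y] by auto
    then have "(y, c) \<in> (adj (E \<inter> Pow (insert c T)))\<^sup>*" "(x, y) \<in> adj (E \<inter> Pow (insert c T))"
      using step by auto
    then show ?thesis by (rule converse_rtrancl_into_rtrancl[rotated])
  qed
qed

text \<open>With \<open>u\<close> removed, the component of \<open>l\<close> is an interval
  \<open>{l..<m}\<close>. Cutting it at its unique neighbour \<open>c\<close> of \<open>u\<close>
  gives \<open>L\<close> and \<open>R\<close>; the labels from \<open>m\<close> on, still joined to
  \<open>u\<close>, give \<open>F\<close>. All three intervals are shorter.\<close>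

lemma forest_decomposition:
  assumes cf: "crossfree E" and ac: "\<not> has_cycle E"
    and dbl: "\<And>e. e \<in> E \<Longrightarrow> \<exists>x y. e = {x, y}" and nl: "\<And>x. {x} \<notin> E"
    and "l \<le> r" "u \<notin> {l..<r}" "\<And>z. z \<in> {l..<r} \<Longrightarrow> (z, u) \<in> (adj (E \<inter> Pow (insert u {l..<r})))\<^sup>*"
  shows "\<exists>t. l + size t = r \<and> E \<inter> Pow (insert u {l..<r}) = fedges t u l"
  using assms(5-)
proof (induction "r - l" arbitrary: l r u rule: less_induct)
  case less
  let ?D = "{l..<r}"
  note u = less.prems(2) and conn = less.prems(3)
  have cross: "False" if "{p, q} \<in> E" "{x, y} \<in> E" "p < x" "x < q" "y < p \<or> q < y" for p q x y
  proof -
    have "{q, p} \<in> E" "{y, x} \<in> E" using that by (simp_all add: insert_commute)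
    then show False using cf that unfolding crossfree_def by metis
  qed
  show ?case
  proof (cases "l = r")
    case True
    have "E \<inter> Pow {u} = {}" using dbl nl by (fastforce simp: subset_singleton_iff)
    then show ?thesis using True by (intro exI[of _ Void]) simp
  next
    case False
    then have lr: "l < r" using less.prems by simp
    define R where "R = (adj (E \<inter> Pow ?D))\<^sup>*"
    have R_sym: "(x, y) \<in> R \<Longrightarrow> (y, x) \<in> R" for x y unfolding R_def by (rule adj_rtrancl_sym)
    have R_trans: "(x, y) \<in> R \<Longrightarrow> (y, z) \<in> R \<Longrightarrow> (x, z) \<in> R" for x y z unfolding R_def by simp
    have R_edge: "{x, y} \<in> E \<Longrightarrow> x \<in> ?D \<Longrightarrow> y \<in> ?D \<Longrightarrow> (x, y) \<in> R" for x y
      unfolding R_def by (intro r_into_rtrancl) simp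
    \<comment> \<open>The leaving edge is taken on the walk itself, so that its first end is still
      in the component of \<open>x\<close>.\<close>
    have R_leaves: "\<exists>p q. {p, q} \<in> E \<and> p \<in> ?D \<and> q \<in> ?D \<and> (x, p) \<in> R \<and> P p \<and> \<not> P q"
      if R: "(x, y) \<in> R" and P: "P x" "\<not> P y" for x y P
    proof -
      have "(x, y) \<in> (adj (E \<inter> Pow ?D) \<inter> {(p, q). (x, p) \<in> R})\<^sup>*"
        using R unfolding R_def
      proof (induction rule: rtrancl_induct)
        case (step p q)
        then show ?case by (intro rtrancl_into_rtrancl[OF step.IH]) auto
      qed simp
      from rtrancl_leaves[of x y _ P, OF this P] show ?thesis by auto
    qed
    \<comment> \<open>The walk from \<open>z\<close> to \<open>u\<close> leaves the component of
      \<open>z\<close>, and the edge on which it does so can only lead to \<open>u\<close>.\<close>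
    have top: "\<exists>v\<in>?D. {u, v} \<in> E \<and> (z, v) \<in> R" if zD: "z \<in> ?D" for z
    proof -
      let ?P = "\<lambda>y. y \<in> ?D \<and> (z, y) \<in> R"
      obtain a b where ab: "{a, b} \<in> E" "{a, b} \<subseteq> insert u ?D" "?P a" "\<not> ?P b"
        using rtrancl_leaves[of z u _ ?P, OF conn[OF zD]] zD u unfolding R_def by auto
      then have "b = u" using R_edge[of a b] R_trans[of z a b] by auto
      then show ?thesis using ab by (auto simp: insert_commute)
    qed
    have top_unique: "x = y" if "{u, x} \<in> E" "{u, y} \<in> E" "(x, y) \<in> R" for x y
      using two_edges_to_component_cycle[of x y E ?D u] that ac u unfolding R_def by blast
    define c where "c = (LEAST v. v \<in> ?D \<and> {u, v} \<in> E)"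
    have c: "c \<in> ?D" "{u, c} \<in> E" and c_least: "\<And>v. v \<in> ?D \<Longrightarrow> {u, v} \<in> E \<Longrightarrow> c \<le> v"
    proof -
      obtain v where "v \<in> ?D \<and> {u, v} \<in> E" using top[of l] lr by auto
      from LeastI[of "\<lambda>v. v \<in> ?D \<and> {u, v} \<in> E", OF this] show "c \<in> ?D" "{u, c} \<in> E"
        unfolding c_def by blast+
    qed (auto simp: c_def intro: Least_le)
    have cu: "{c, u} \<in> E" using c(2) by (simp add: insert_commute)
    text \<open>An edge of a component passing over a vertex that it does not contain would have to be
      crossed on the way from that vertex to \<open>u\<close>.\<close>
    have interval: "y \<in> ?D \<Longrightarrow> (x, y) \<in> R"
      if x: "x \<in> ?D" and z: "(x, z) \<in> R" and y: "x < y" "y < z" for x y z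
    proof (rule ccontr)
      assume nR: "(x, y) \<notin> R" and yD: "y \<in> ?D"
      obtain a b where ab: "{a, b} \<in> E" "a < y" "\<not> b < y" "(x, a) \<in> R" "a \<in> ?D" "b \<in> ?D"
        using R_leaves[OF z, of "\<lambda>v. v < y"] y by auto
      have xb: "(x, b) \<in> R" using R_trans[OF ab(4) R_edge] ab by blast
      have "b \<noteq> y" using xb nR by auto
      then have b: "y < b" using ab(3) by simp
      obtain v where v: "v \<in> ?D" "{u, v} \<in> E" "(y, v) \<in> R" using top[OF yD] by blast
      have not_comp: "w \<noteq> a \<and> w \<noteq> b" if "(y, w) \<in> R" for w
        using that nR ab(4) xb R_sym R_trans by metis
      \<comment> \<open>The component of \<open>y\<close> is trapped under \<open>{a, b}\<close>: to
        get out it would have to cross this edge or to pass through \<open>a\<close> or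
        \<open>b\<close>, which belong to the component of \<open>x\<close>.\<close>
      have in_ab: "a < w \<and> w < b" if yw: "(y, w) \<in> R" for w
      proof (rule ccontr)
        assume "\<not> (a < w \<and> w < b)"
        then obtain p q where pq: "{p, q} \<in> E" "p \<in> ?D" "q \<in> ?D" "(y, p) \<in> R"
            "a < p" "p < b" "\<not> (a < q \<and> q < b)"
          using R_leaves[OF yw, of "\<lambda>w. a < w \<and> w < b"] ab(2) b by auto
        then have "(y, q) \<in> R" using R_trans R_edge by blast
        then have "q < a \<or> b < q" using pq not_comp[of q] by auto
        then show False using cross[OF ab(1) pq(1)] pq by blast
      qed
      have "u < a \<or> b < u" using u ab by auto
      moreover have "{v, u} \<in> E" using v(2) by (simp add: insert_commute)
      ultimately show False using cross[OF ab(1), of v u] in_ab[OF v(3)] by blast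
    qed
    \<comment> \<open>The component of \<open>l\<close> is joined to \<open>u\<close> through some
      \<open>v\<close>, and \<open>c \<le> v\<close> by minimality; as components have no gaps, it
      contains \<open>c\<close>.\<close>
    have lc: "(l, c) \<in> R"
    proof -
      obtain v where v: "v \<in> ?D" "{u, v} \<in> E" "(l, v) \<in> R" using top[of l] lr by auto
      then have "c = l \<or> c = v \<or> l < c \<and> c < v" using c_least[of v] c(1) by auto
      then show ?thesis using interval[of l v c] v lr c(1) by (auto simp: R_def)
    qed
    define B where "B = {x \<in> ?D. (l, x) \<in> R}"
    define m where "m = Suc (Max B)"
    have B: "finite B" "l \<in> B" "c \<in> B" using lc lr c by (auto simp: B_def R_def)
    have MB: "Max B \<in> B" using B by (intro Max_in) auto
    have B_eq: "B = {l..<m}"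
    proof
      show "B \<subseteq> {l..<m}" unfolding m_def using B(1) by (auto simp: B_def less_Suc_eq_le)
      show "{l..<m} \<subseteq> B"
      proof
        fix y assume "y \<in> {l..<m}"
        then have "y = l \<or> y = Max B \<or> l < y \<and> y < Max B" by (auto simp: m_def)
        moreover have "y \<in> B" if "l < y \<and> y < Max B"
        proof -
          have "Max B \<in> ?D" "(l, Max B) \<in> R" using MB by (auto simp: B_def)
          then have "y \<in> ?D" "(l, y) \<in> R" using that interval[of l "Max B" y] lr by auto
          then show ?thesis by (simp add: B_def)
        qed
        ultimately show "y \<in> B" using MB B by auto
      qed
    qed
    have BD: "B \<subseteq> ?D" by (auto simp: B_def)
    have "c < m" using B(3) unfolding B_eq by simp
    moreover have "m \<le> r" using subsetD[OF BD MB] by (simp add: m_def)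
    ultimately have m: "c < m" "m \<le> r" .
    have lc': "l \<le> c" "c < r" using c by auto
    have uB: "u < l \<or> r \<le> u" using u by auto
    have closed: "y \<in> B" if "{x, y} \<in> E" "x \<in> B" "y \<in> ?D" for x y
      using that R_edge[of x y] R_trans[of l x y] by (auto simp: B_def)
    have connB: "(z, c) \<in> (adj (E \<inter> Pow B))\<^sup>*" if "z \<in> B" for z
    proof -
      have "(z, c) \<in> (adj (E \<inter> Pow ?D))\<^sup>*"
        using that R_sym R_trans lc unfolding B_def R_def[symmetric] by blast
      then have "(z, c) \<in> (adj (E \<inter> Pow (insert c B)))\<^sup>*"
        using that by (rule rtrancl_first_hit) (use closed in auto)
      then show ?thesis using B by (simp add: insert_absorb)
    qed
    \<comment> \<open>Such an edge would cross \<open>{c, u}\<close>, because \<open>u\<close> is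
      outside the interval.\<close>
    have under: "\<not> (x < c \<and> c < y)" if "{x, y} \<in> E" "{x, y} \<subseteq> B" for x y
      using cross[OF that(1) cu] that(2) uB m B_eq by auto
    have under': "\<not> (y < c \<and> c < x)" if "{x, y} \<in> E" "{x, y} \<subseteq> B" for x y
      using under[of y x] that by (auto simp: insert_commute)
    have "\<exists>L. l + size L = c \<and> E \<inter> Pow (insert c {l..<c}) = fedges L c l"
    proof (rule less.hyps)
      fix z assume z: "z \<in> {l..<c}"
      have "(z, c) \<in> (adj (E \<inter> Pow B))\<^sup>*" using z B_eq m by (intro connB) auto
      then show "(z, c) \<in> (adj (E \<inter> Pow (insert c {l..<c})))\<^sup>*"
        by (rule rtrancl_first_hit[OF _ z]) (use under B_eq in \<open>fastforce simp: not_less\<close>)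
    qed (use lc' lr in auto)
    then obtain L where L: "l + size L = c" "E \<inter> Pow (insert c {l..<c}) = fedges L c l" by blast
    have "\<exists>R. Suc c + size R = m \<and> E \<inter> Pow (insert c {Suc c..<m}) = fedges R c (Suc c)"
    proof (rule less.hyps)
      fix z assume z: "z \<in> {Suc c..<m}"
      have "(z, c) \<in> (adj (E \<inter> Pow B))\<^sup>*" using z B_eq lc' by (intro connB) auto
      then show "(z, c) \<in> (adj (E \<inter> Pow (insert c {Suc c..<m})))\<^sup>*"
        by (rule rtrancl_first_hit[OF _ z]) (use under' B_eq in \<open>fastforce simp: not_less\<close>)
    qed (use lc' lr m in auto)
    then obtain R' where R': "Suc c + size R' = m" "E \<inter> Pow (insert c {Suc c..<m}) = fedges R' c (Suc c)"
      by blast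
    \<comment> \<open>\<open>B\<close> is a whole component, so no edge from a label beyond it leads
      into it.\<close>
    have away: "y \<in> {m..<r}" if "{x, y} \<in> E" "x \<in> {m..<r}" "y \<in> ?D" for x y
      using that closed[of y x] B_eq lc' m by (force simp: insert_commute)
    have "\<exists>F. m + size F = r \<and> E \<inter> Pow (insert u {m..<r}) = fedges F u m"
    proof (rule less.hyps)
      fix z assume z: "z \<in> {m..<r}"
      have "(z, u) \<in> (adj (E \<inter> Pow (insert u ?D)))\<^sup>*" using z m lc' by (intro conn) auto
      then show "(z, u) \<in> (adj (E \<inter> Pow (insert u {m..<r})))\<^sup>*"
        by (rule rtrancl_first_hit[OF _ z]) (use away in auto)
    qed (use lc' lr m u in auto)
    then obtain F where F: "m + size F = r" "E \<inter> Pow (insert u {m..<r}) = fedges F u m" by blast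
    have "E \<inter> Pow (insert u ?D) = insert {u, c} (E \<inter> Pow (insert c {l..<c}) \<union>
        E \<inter> Pow (insert c {Suc c..<m}) \<union> E \<inter> Pow (insert u {m..<r}))" (is "?A = ?B")
    proof
      show "?B \<subseteq> ?A" using c m lc' by auto
      show "?A \<subseteq> ?B"
      proof
        fix e assume e: "e \<in> ?A"
        have pq: "{x, y} \<in> ?B" if E: "{x, y} \<in> E" and S: "{x, y} \<subseteq> insert u ?D" and x: "x \<in> B" for x y
        proof (cases "y = u")
          case True
          have "(x, c) \<in> R" using x lc R_sym R_trans unfolding B_def by blast
          then have "x = c" using E c(2) True by (intro top_unique) (auto simp: insert_commute)
          then show ?thesis using True by (simp add: insert_commute)
        next
          case False
          then have "y \<in> B" using closed[OF E x] S by auto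
          then have "{x, y} \<subseteq> insert c {l..<c} \<or> {x, y} \<subseteq> insert c {Suc c..<m}"
            using under[OF E] under'[OF E] x B_eq by auto
          then show ?thesis using E by auto
        qed
        obtain x y where xy: "e = {x, y}" using dbl e by blast
        show "e \<in> ?B"
        proof (cases "x \<in> B \<or> y \<in> B")
          case True
          then show ?thesis using pq[of x y] pq[of y x] e xy by (auto simp: insert_commute)
        next
          case False
          then have "{x, y} \<subseteq> insert u {m..<r}" using e xy B_eq by auto
          then show ?thesis using e xy by auto
        qed
      qed
    qed
    also have "\<dots> = fedges (Hang L R' F) u l"
      unfolding L(2) R'(2) F(2) using L(1) R'(1) by simp
    finally show ?thesis using L(1) R'(1) F(1) by (intro exI[of _ "Hang L R' F"]) simp
  qed
qed

lemma NC_fedges: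
  assumes "E \<in> NC n"
  shows "\<exists>t. n = Suc (size t) \<and> E = fedges t 0 1"
proof -
  from assms have E: "E \<subseteq> {{u, v} | u v. u \<in> {..<n} \<and> v \<in> {..<n} \<and> u \<noteq> v}" "0 < n"
    "\<And>u v. u < n \<Longrightarrow> v < n \<Longrightarrow> (u, v) \<in> (adj E)\<^sup>*" "\<not> has_cycle E" "crossfree E"
    unfolding NC_iff by blast+
  have ins: "insert 0 {1..<n} = {..<n}" using E(2) by auto
  have EP: "E \<inter> Pow {..<n} = E" using NC_subset[OF assms] by blast
  have "\<exists>t. 1 + size t = n \<and> E \<inter> Pow (insert 0 {1..<n}) = fedges t 0 1"
  proof (rule forest_decomposition[OF E(5,4)])
    show "\<exists>x y. e = {x, y}" if "e \<in> E" for e using that E(1) by blast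
    show "{x} \<notin> E" for x using E(1) by blast
    show "(z, 0) \<in> (adj (E \<inter> Pow (insert 0 {1..<n})))\<^sup>*" if "z \<in> {1..<n}" for z
      unfolding ins EP using that E(2) by (intro E(3)) auto
  qed (use E(2) in auto)
  then show ?thesis using EP unfolding ins by auto
qed

section \<open>Injectivity of the encoding\<close>

text \<open>If the label just after \<open>R\<close> belonged to \<open>R'\<close>, it would be
  joined to the child without passing through \<open>u\<close>; but in the first encoding every edge
  over this boundary contains \<open>u\<close>.\<close>

lemma fedges_Hang_size_le:
  assumes eq: "fedges (Hang L R F) u l = fedges (Hang L' R' F') u l" and L: "size L = size L'"
    and sz: "size (Hang L R F) = size (Hang L' R' F')" and u: "u \<notin> labels (Hang L R F) l"
  shows "size R' \<le> size R"
proof (rule ccontr)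
  let ?c = "l + size L"
  let ?z = "Suc (?c + size R)"
  assume "\<not> size R' \<le> size R"
  then have R: "size R < size R'" by simp
  then have zc: "(?z, ?c) \<in> (adj (fedges R' ?c (Suc ?c)))\<^sup>*" by (intro fedges_connected) auto
  then obtain a b where ab: "{a, b} \<in> fedges R' ?c (Suc ?c)" "?z \<le> a" "b < ?z"
    using rtrancl_leaves[OF zc, of "\<lambda>x. ?z \<le> x"] by (auto simp: not_le)
  have "{a, b} \<in> fedges (Hang L R F) u l" unfolding eq using ab(1) L by simp
  moreover have "a \<noteq> u" "b \<noteq> u"
    using fedges_subset[OF ab(1)] u sz L by auto
  ultimately show False
    using ab(2,3) fedges_subset[of "{a, b}" L ?c l] fedges_subset[of "{a, b}" R ?c "Suc ?c"]
      fedges_subset[of "{a, b}" F u ?z] by (auto simp: doubleton_eq_iff)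
qed

text \<open>An edge of any other piece has an end outside the given set, by
  \<open>fedges_meets_labels\<close>, and so has the edge \<open>{u, c}\<close>.\<close>

lemma fedges_Hang_restrict:
  fixes L R F u l
  defines "c \<equiv> l + size L"
  defines "m \<equiv> Suc (c + size R)"
  assumes u: "u \<notin> labels (Hang L R F) l"
  shows "fedges (Hang L R F) u l \<inter> Pow {l..c} = fedges L c l"
    "fedges (Hang L R F) u l \<inter> Pow {c..<m} = fedges R c (Suc c)"
    "fedges (Hang L R F) u l \<inter> Pow (insert u {m..<m + size F}) = fedges F u m"
proof -
  note defs = c_def m_def
  have L: "\<exists>x\<in>{l..<c}. x \<in> e" "e \<subseteq> {l..c}" if "e \<in> fedges L c l" for e
    using fedges_meets_labels[OF that] fedges_subset[OF that] by (auto simp: defs)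
  have R: "\<exists>x\<in>{Suc c..<m}. x \<in> e" "e \<subseteq> {c..<m}" if "e \<in> fedges R c (Suc c)" for e
    using fedges_meets_labels[OF that] fedges_subset[OF that] by (auto simp: defs)
  have F: "\<exists>x\<in>{m..<m + size F}. x \<in> e" "e \<subseteq> insert u {m..<m + size F}" if "e \<in> fedges F u m" for e
    using fedges_meets_labels[OF that] fedges_subset[OF that] by (auto simp: defs)
  have E: "fedges (Hang L R F) u l = insert {u, c} (fedges L c l \<union> fedges R c (Suc c) \<union> fedges F u m)"
    by (simp add: defs)
  have u': "u < l \<or> m + size F \<le> u" using u by (auto simp: defs)
  have cm: "l \<le> c" "c < m" by (auto simp: defs)
  have "e \<notin> Pow {l..c}" if "e = {u, c} \<or> e \<in> fedges R c (Suc c) \<or> e \<in> fedges F u m" for e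
    using that R(1)[of e] F(1)[of e] u' cm by fastforce
  then show "fedges (Hang L R F) u l \<inter> Pow {l..c} = fedges L c l"
    unfolding E using L(2) by blast
  have "e \<notin> Pow {c..<m}" if "e = {u, c} \<or> e \<in> fedges L c l \<or> e \<in> fedges F u m" for e
    using that L(1)[of e] F(1)[of e] u' cm by fastforce
  then show "fedges (Hang L R F) u l \<inter> Pow {c..<m} = fedges R c (Suc c)"
    unfolding E using R(2) by blast
  have "e \<notin> Pow (insert u {m..<m + size F})"
    if "e = {u, c} \<or> e \<in> fedges L c l \<or> e \<in> fedges R c (Suc c)" for e
    using that L(1)[of e] R(1)[of e] u' cm by fastforce
  then show "fedges (Hang L R F) u l \<inter> Pow (insert u {m..<m + size F}) = fedges F u m"
    unfolding E using F(2) by blast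
qed

text \<open>The sizes are recovered in turn: that of \<open>L\<close> from the smallest neighbour of
  \<open>u\<close>, that of \<open>R\<close> by comparison in both directions, that of
  \<open>F\<close> from the total. The edges of each piece then follow by restriction.\<close>

lemma fedges_inj:
  assumes "fedges t u l = fedges t' u l" "size t = size t'" "u \<notin> labels t l"
  shows "t = t'"
  using assms
proof (induction t arbitrary: t' u l)
  case Void
  then show ?case by (cases t') auto
next
  case (Hang L R F)
  obtain L' R' F' where t': "t' = Hang L' R' F'" using Hang.prems(2) by (cases t') auto
  note eq = Hang.prems(1)[unfolded t'] and sz = Hang.prems(2)[unfolded t'] and u = Hang.prems(3)
  have u': "u \<notin> labels (Hang L' R' F') l" using u sz by simp
  have "set (roots (Hang L R F) l) = set (roots (Hang L' R' F') l)"
    using fedges_root_iff[OF u] fedges_root_iff[OF u'] eq by blast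
  then have "roots (Hang L R F) l = roots (Hang L' R' F') l"
    by (metis sorted_roots sorted_distinct_set_unique strict_sorted_iff)
  then have L: "size L = size L'" by simp
  have "size R' \<le> size R" "size R \<le> size R'"
    using fedges_Hang_size_le[OF eq L sz u] fedges_Hang_size_le[OF eq[symmetric] L[symmetric] sz[symmetric] u']
    by auto
  then have R: "size R = size R'" by simp
  have F: "size F = size F'" using sz L R by simp
  note res = fedges_Hang_restrict[OF u] and res' = fedges_Hang_restrict[OF u']
  have "L = L'" using res(1) res'(1) eq L by (intro Hang.IH(1)) auto
  moreover have "R = R'" using res(2) res'(2) eq L R by (intro Hang.IH(2)) auto
  moreover have "F = F'" using res(3) res'(3) eq L R F u by (intro Hang.IH(3)) auto
  ultimately show ?case using t' by simp
qed

lemma bij_betw_fedges: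
  assumes "n \<ge> 1"
  shows "bij_betw (\<lambda>t. fedges t 0 1) {t. Suc (size t) = n} (NC n)"
  unfolding bij_betw_def
proof
  show "inj_on (\<lambda>t. fedges t 0 1) {t. Suc (size t) = n}"
    by (rule inj_onI, rule fedges_inj) auto
  show "(\<lambda>t. fedges t 0 1) ` {t. Suc (size t) = n} = NC n"
    using fedges_NC NC_fedges by blast
qed

section \<open>Counting the noncrossing trees of a given shape\<close>

text \<open>The two \<open>length ts + 1\<close> have different origins: the factor counts
  splittings, the argument of \<open>w\<close> is the degree, parent included.\<close>

primrec shape_weight :: "(nat \<Rightarrow> real) \<Rightarrow> plane_tree \<Rightarrow> real" where
  "shape_weight w (PNode ts) =
     real (length ts + 1) * w (length ts + 1) * prod_list (map (shape_weight w) ts)"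

lemma size_forest: "size t = sum_list (map num_vertices (shapes t))"
  by (induction t) auto

lemma num_vertices_pos: "num_vertices t > 0"
  by (cases t) simp

lemma shapes_Nil_iff: "shapes t = [] \<longleftrightarrow> t = Void"
  by (cases t) auto

text \<open>Serves to show that finitely many plane trees have \<open>n\<close> vertices. The
  witness puts every child on the right.\<close>

lemma shapes_surj: "\<exists>t. shapes t = ts"
proof (induction "sum_list (map num_vertices ts)" arbitrary: ts rule: less_induct)
  case less
  show ?case
  proof (cases ts)
    case Nil
    then show ?thesis by (intro exI[of _ Void]) simp
  next
    case (Cons s rs)
    obtain ss where s: "s = PNode ss" by (cases s)
    obtain R F where "shapes R = ss" "shapes F = rs"
      using less[of ss] less[of rs] num_vertices_pos[of s] by (auto simp: Cons s)
    then show ?thesis by (intro exI[of _ "Hang Void R F"]) (simp add: Cons s)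
  qed
qed

text \<open>The factor \<open>length ss + 1\<close> of \<^const>\<open>shape_weight\<close> counts the ways of distributing the ordered
  children of a vertex to its left and to its right.\<close>

lemma shapes_fibre_Cons:
  "{t. shapes t = PNode ss # ts} = (\<lambda>(j, L, R, F). Hang L R F) `
     (SIGMA j:{..length ss}. {t. shapes t = take j ss} \<times> {t. shapes t = drop j ss} \<times> {t. shapes t = ts})"
  (is "?A = ?f ` ?B")
proof
  show "?f ` ?B \<subseteq> ?A" by auto
  show "?A \<subseteq> ?f ` ?B"
  proof
    fix t assume "t \<in> ?A"
    then obtain L R F where t: "t = Hang L R F" "ss = shapes L @ shapes R" "shapes F = ts"
      by (cases t) auto
    then have "(length (shapes L), L, R, F) \<in> ?B" by auto
    then show "t \<in> ?f ` ?B" using t(1) by force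
  qed
qed

lemma inj_on_shapes_fibre:
  "inj_on (\<lambda>(j, L, R, F). Hang L R F)
     (SIGMA j:{..length ss}. {t. shapes t = take j ss} \<times> {t. shapes t = drop j ss} \<times> {t. shapes t = ts})"
  (is "inj_on ?f ?B")
proof (rule inj_onI)
  fix x y assume B: "x \<in> ?B" "y \<in> ?B" and eq: "?f x = ?f y"
  obtain j L R F where x: "x = (j, L, R, F)" by (cases x)
  obtain j' where y: "y = (j', L, R, F)" using eq by (cases y) (auto simp: x)
  have "length (take j ss) = length (take j' ss)" using B by (simp add: x y)
  then have "j = j'" using B by (simp add: x y)
  then show "x = y" by (simp add: x y)
qed

text \<open>For a fixed split the sum factorises over \<open>L\<close>, \<open>R\<close> and
  \<open>F\<close>, and the product of the two parts of \<open>ss\<close> does not depend on the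
  split; so the \<open>length ss + 1\<close> splits contribute equally.\<close>

lemma sum_fweight_shapes:
  "finite {t. shapes t = ts} \<and> (\<Sum>t | shapes t = ts. fweight w t) = prod_list (map (shape_weight w) ts)"
proof (induction "sum_list (map num_vertices ts)" arbitrary: ts rule: less_induct)
  case less
  show ?case
  proof (cases ts)
    case Nil
    then show ?thesis by (simp add: shapes_Nil_iff)
  next
    case (Cons s rs)
    obtain ss where s: "s = PNode ss" by (cases s)
    let ?T = "\<lambda>ts. {t. shapes t = ts}" and ?W = "\<lambda>ts. prod_list (map (shape_weight w) ts)"
    let ?k = "length ss"
    have split: "sum_list (map num_vertices ss) =
        sum_list (map num_vertices (take j ss)) + sum_list (map num_vertices (drop j ss))" for j
      by (metis append_take_drop_id map_append sum_list_append)
    have IHt: "finite (?T (take j ss))" "sum (fweight w) (?T (take j ss)) = ?W (take j ss)" for j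
      using less[of "take j ss"] split[of j] by (auto simp: Cons s)
    have IHd: "finite (?T (drop j ss))" "sum (fweight w) (?T (drop j ss)) = ?W (drop j ss)" for j
      using less[of "drop j ss"] split[of j] by (auto simp: Cons s)
    have IHr: "finite (?T rs)" "sum (fweight w) (?T rs) = ?W rs"
      using less[of rs] num_vertices_pos[of s] by (auto simp: Cons)
    have fin: "finite (?T ts)"
      unfolding Cons s shapes_fibre_Cons using IHt(1) IHd(1) IHr(1) by (intro finite_imageI) auto
    have "sum (fweight w) (?T ts) = (\<Sum>(j, L, R, F)\<in>(SIGMA j:{..?k}. ?T (take j ss) \<times> ?T (drop j ss) \<times> ?T rs).
        w (Suc ?k) * fweight w L * fweight w R * fweight w F)"
      unfolding Cons s shapes_fibre_Cons sum.reindex[OF inj_on_shapes_fibre]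
      by (intro sum.cong) auto
    also have "\<dots> = (\<Sum>j\<le>?k. \<Sum>(L, R, F)\<in>?T (take j ss) \<times> ?T (drop j ss) \<times> ?T rs.
        w (Suc ?k) * fweight w L * fweight w R * fweight w F)"
      using IHt(1) IHd(1) IHr(1) by (subst sum.Sigma) auto
    also have "\<dots> = (\<Sum>j\<le>?k. w (Suc ?k) * ?W (take j ss) * ?W (drop j ss) * ?W rs)"
      unfolding IHt(2)[symmetric] IHd(2)[symmetric] IHr(2)[symmetric]
      by (simp add: sum.cartesian_product[symmetric] sum_distrib_left sum_distrib_right mult_ac)
    also have "\<dots> = (\<Sum>j\<le>?k. w (Suc ?k) * ?W ss * ?W rs)"
    proof (rule sum.cong)
      fix j
      have "?W ss = ?W (take j ss) * ?W (drop j ss)"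
        by (metis append_take_drop_id map_append prod_list.append)
      then show "w (Suc ?k) * ?W (take j ss) * ?W (drop j ss) * ?W rs = w (Suc ?k) * ?W ss * ?W rs"
        by simp
    qed simp
    also have "\<dots> = ?W ts" by (simp add: Cons s)
    finally show ?thesis using fin by simp
  qed
qed

lemma sum_weight_shape:
  assumes "n \<ge> 1"
  shows "(\<Sum>E | E \<in> NC n \<and> shape n E = PNode ts. weight w n E) =
    (if num_vertices (PNode ts) = n then w (length ts) * prod_list (map (shape_weight w) ts) else 0)"
proof -
  have bij: "bij_betw (\<lambda>t. fedges t 0 1) {t. Suc (size t) = n \<and> shapes t = ts}
      {E \<in> NC n. shape n E = PNode ts}"
  proof (rule bij_betw_imageI)
    show "inj_on (\<lambda>t. fedges t 0 1) {t. Suc (size t) = n \<and> shapes t = ts}"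
      by (rule inj_on_subset[OF bij_betw_imp_inj_on[OF bij_betw_fedges[OF assms]]]) blast
    show "(\<lambda>t. fedges t 0 1) ` {t. Suc (size t) = n \<and> shapes t = ts} =
        {E \<in> NC n. shape n E = PNode ts}"
    proof
      show "(\<lambda>t. fedges t 0 1) ` {t. Suc (size t) = n \<and> shapes t = ts} \<subseteq>
          {E \<in> NC n. shape n E = PNode ts}"
        using fedges_NC shape_fedges by blast
      show "{E \<in> NC n. shape n E = PNode ts} \<subseteq>
          (\<lambda>t. fedges t 0 1) ` {t. Suc (size t) = n \<and> shapes t = ts}"
      proof
        fix E assume E: "E \<in> {E \<in> NC n. shape n E = PNode ts}"
        then obtain t where t: "n = Suc (size t)" "E = fedges t 0 1" using NC_fedges by blast
        moreover have "shapes t = ts" using E shape_fedges[OF t(1)] unfolding t(2) by simp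
        ultimately show "E \<in> (\<lambda>t. fedges t 0 1) ` {t. Suc (size t) = n \<and> shapes t = ts}" by blast
      qed
    qed
  qed
  have "(\<Sum>E | E \<in> NC n \<and> shape n E = PNode ts. weight w n E) =
      (\<Sum>t | Suc (size t) = n \<and> shapes t = ts. weight w n (fedges t 0 1))"
    by (rule sum.reindex_bij_betw[OF bij, symmetric])
  also have "\<dots> = (\<Sum>t | Suc (size t) = n \<and> shapes t = ts. w (length ts) * fweight w t)"
    using weight_fedges by (intro sum.cong refl) blast
  also have "{t. Suc (size t) = n \<and> shapes t = ts} =
      (if num_vertices (PNode ts) = n then {t. shapes t = ts} else {})"
    by (auto simp: size_forest)
  finally show ?thesis
    using sum_fweight_shapes[of ts w] by (simp add: sum_distrib_left[symmetric] split: if_splits)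
qed

section \<open>The law of the shape\<close>

lemma pmf_embed_pmf_sums:
  fixes f :: "nat \<Rightarrow> real"
  assumes "\<And>k. 0 \<le> f k" "f sums 1"
  shows "pmf (embed_pmf f) k = f k"
proof (rule pmf_embed_pmf)
  have "(\<integral>\<^sup>+x. ennreal (f x) \<partial>count_space UNIV) = (\<Sum>x. ennreal (f x))"
    by (rule nn_integral_count_space_nat)
  also have "\<dots> = ennreal (\<Sum>x. f x)"
    using assms by (intro suminf_ennreal2) (auto simp: sums_iff)
  finally show "(\<integral>\<^sup>+x. ennreal (f x) \<partial>count_space UNIV) = 1"
    using assms(2) by (simp add: sums_iff)
qed (use assms in auto)

lemma prod_list_scaled:
  fixes f g :: "'a \<Rightarrow> real"
  assumes "\<And>t. t \<in> set ts \<Longrightarrow> f t * b = g t * d ^ m t"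
  shows "prod_list (map f ts) * b ^ length ts = prod_list (map g ts) * d ^ sum_list (map m ts)"
  using assms
proof (induction ts)
  case (Cons t ts)
  have "prod_list (map f (t # ts)) * b ^ length (t # ts) =
      (f t * b) * (prod_list (map f ts) * b ^ length ts)"
    by (simp add: mult_ac)
  also have "\<dots> = (g t * d ^ m t) * (prod_list (map g ts) * d ^ sum_list (map m ts))"
    using Cons by simp
  finally show ?case by (simp add: power_add mult_ac)
qed simp

lemma gw_mass_shape_weight:
  assumes "\<And>k. pmf \<mu> k = a * real (k + 1) * w (k + 1) * b ^ k"
  shows "gw_mass \<mu> \<tau> * b = shape_weight w \<tau> * (a * b) ^ num_vertices \<tau>"
proof (induction \<tau>)
  case (PNode ts)
  have *: "prod_list (map (gw_mass \<mu>) ts) * b ^ length ts =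
      prod_list (map (shape_weight w) ts) * (a * b) ^ sum_list (map num_vertices ts)"
    by (rule prod_list_scaled) (rule PNode.IH)
  have "gw_mass \<mu> (PNode ts) * b = a * b * (real (length ts + 1) * w (length ts + 1)) *
      (prod_list (map (gw_mass \<mu>) ts) * b ^ length ts)"
    unfolding gw_mass.simps assms by (simp only: mult_ac)
  also have "\<dots> = shape_weight w (PNode ts) * (a * b) ^ num_vertices (PNode ts)"
    unfolding *
    by (simp only: shape_weight.simps num_vertices.simps power_Suc mult_ac)
  finally show ?case .
qed

text \<open>The root's \<open>b ^ length ts\<close> hands one \<open>b\<close> to each subtree,
  which is exactly what completes the power there.\<close>

lemma bgw_mass_shape_weight:
  assumes \<mu>: "\<And>k. pmf \<mu> k = a * real (k + 1) * w (k + 1) * b ^ k"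
    and \<mu>0: "\<And>k. pmf \<mu>0 k = (if k \<ge> 1 then c * w k * b ^ k else 0)"
    and n: "num_vertices (PNode ts) = n" "n \<ge> 2"
  shows "bgw_mass \<mu>0 \<mu> (PNode ts) =
     c * (a * b) ^ (n - 1) * (w (length ts) * prod_list (map (shape_weight w) ts))"
proof -
  \<comment> \<open>As \<open>n \<ge> 2\<close>, the root has a child and the nonzero branch of
    \<open>\<mu>0\<close> applies.\<close>
  have "ts \<noteq> []" using n by auto
  then have "length ts \<ge> 1" by (cases ts) auto
  then have "bgw_mass \<mu>0 \<mu> (PNode ts) = c * w (length ts) * (prod_list (map (gw_mass \<mu>) ts) * b ^ length ts)"
    by (simp add: bgw_mass_def \<mu>0 mult_ac)
  moreover have "sum_list (map num_vertices ts) = n - 1" using n by simp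
  ultimately show ?thesis
    unfolding prod_list_scaled[of ts "gw_mass \<mu>" b "shape_weight w" "a * b" num_vertices, OF gw_mass_shape_weight[OF \<mu>]] by (simp add: mult_ac)
qed

lemma spmf_cond_spmf_proportional:
  fixes p :: "'a spmf" and S :: "'a \<Rightarrow> real"
  assumes "finite A" "K \<noteq> 0" "\<And>x. x \<in> A \<Longrightarrow> spmf p x = K * S x" "x \<in> A"
  shows "spmf (cond_spmf p A) x = S x / sum S A"
proof -
  have "measure (measure_spmf p) A = (\<Sum>x\<in>A. spmf p x)"
    using assms(1) by (subst measure_spmf.finite_measure_eq_sum_singleton) (auto simp: spmf_conv_measure_spmf)
  also have "\<dots> = K * sum S A" using assms(3) by (simp add: sum_distrib_left)
  finally show ?thesis using assms by simp
qed

text \<open>The bound on \<open>b\<close> is \<open>conv_radius w\<close>, since \<open>w k\<close>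
  is nonnegative for \<open>k \<ge> 1\<close> and \<open>root 0\<close> is 0. The second series is
  the termwise derivative of the first.\<close>

lemma summable_below_radius:
  fixes w :: "nat \<Rightarrow> real"
  assumes "\<And>k. k \<ge> 1 \<Longrightarrow> w k \<ge> 0" "0 < b" "ereal b < inverse (limsup (\<lambda>k. ereal (root k (w k))))"
  shows "summable (\<lambda>k. w k * b ^ k)" "summable (\<lambda>k. real (k + 1) * w (k + 1) * b ^ k)"
proof -
  have "root k (norm (w k)) = root k (w k)" for k
    using assms(1)[of k] by (cases "k = 0") auto
  then have r: "ereal b < conv_radius w"
    using assms(3) by (simp add: conv_radius_def)
  have s: "summable (\<lambda>k. w k * x ^ k)" if "ereal (norm x) < conv_radius w" for x
    using that by (intro summable_in_conv_radius)
  show "summable (\<lambda>k. w k * b ^ k)" using r assms(2) by (intro s) simp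
  obtain B where B: "ereal b < ereal B" "ereal B < conv_radius w"
    using ereal_dense2[OF r] by blast
  have "summable (\<lambda>k. diffs w k * b ^ k)"
  proof (rule termdiff_converges[where K = B])
    show "norm b < B" using B assms(2) by simp
    show "summable (\<lambda>k. w k * x ^ k)" if "norm x < B" for x
      using that B(2) by (intro s) (meson ereal_less_eq(3) le_less_trans less_imp_le)
  qed
  then show "summable (\<lambda>k. real (k + 1) * w (k + 1) * b ^ k)" by (simp add: diffs_def)
qed

theorem theorem18:
  fixes w :: "nat \<Rightarrow> real" and \<rho> :: ereal and a b c :: real
    and \<mu> \<mu>0 :: "nat \<Rightarrow> real" and n :: nat
  assumes "\<And>k. k \<ge> 1 \<Longrightarrow> w k \<ge> 0"
    and "\<rho> = inverse (limsup (\<lambda>k. ereal (root k (w k))))"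
    and "\<rho> > 0"
    and "0 < b" and "ereal b < \<rho>"
    and "a = inverse (\<Sum>k. real (k + 1) * w (k + 1) * b ^ k)"
    and "c = inverse (\<Sum>k. w (k + 1) * b ^ (k + 1))"
    and "\<And>k. \<mu> k = a * real (k + 1) * w (k + 1) * b ^ k"
    and "\<And>k. \<mu>0 k = (if k \<ge> 1 then c * w k * b ^ k else 0)"
    and "n \<ge> 2" and "Z w n > 0"
  shows "spmf_of_pmf (map_pmf (shape n) (P_NC w n)) = BGW_n n (embed_pmf \<mu>0) (embed_pmf \<mu>)"
proof -
  note w = assms(1) and b = assms(4) and n = assms(10) and Z = assms(11)
  note sm = summable_below_radius[OF w b assms(5)[unfolded assms(2)]]
  have sm': "summable (\<lambda>k. w (k + 1) * b ^ (k + 1))"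
    using sm(1) by (subst summable_iff_shift[of "\<lambda>k. w k * b ^ k" 1])
  \<comment> \<open>The root degree of a tree of nonzero weight provides a positive term in both
    series; otherwise \<open>a\<close> and \<open>c\<close> could be the default
    \<open>inverse 0 = 0\<close>.\<close>
  obtain E where E: "E \<in> NC n" "weight w n E \<noteq> 0"
    using Z unfolding Z_def by (metis less_irrefl sum.neutral)
  have deg: "w (degree E 0) \<noteq> 0" "degree E 0 \<ge> 1"
    using E n degree_NC_ge_1[OF E(1) n, of 0] unfolding weight_def by (auto simp: prod_zero_iff)
  then obtain k where k: "degree E 0 = k + 1" by (metis add.commute le_Suc_ex plus_1_eq_Suc)
  then have wk: "w (k + 1) > 0" using deg w[of "k + 1"] by simp
  define sa where "sa = (\<Sum>k. real (k + 1) * w (k + 1) * b ^ k)"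
  define sc where "sc = (\<Sum>k. w (k + 1) * b ^ (k + 1))"
  have sa: "sa > 0" unfolding sa_def
    by (rule suminf_pos2[OF sm(2), of k]) (use w b wk in auto)
  have sc: "sc > 0" unfolding sc_def
    by (rule suminf_pos2[OF sm', of k]) (use w b wk in auto)
  have a: "a = inverse sa" and c: "c = inverse sc" using assms(6,7) by (simp_all add: sa_def sc_def)
  have ac: "a > 0" "c > 0" using sa sc a c by auto
  \<comment> \<open>Total mass 1 is what makes \<open>embed_pmf\<close> return the prescribed
    masses.\<close>
  have "\<mu> sums (a * sa)"
    using sums_mult[OF summable_sums[OF sm(2)], of a] unfolding sa_def assms(8) by (simp add: mult.assoc)
  then have "\<mu> sums 1" using sa a by simp
  then have pmf_\<mu>: "pmf (embed_pmf \<mu>) k = a * real (k + 1) * w (k + 1) * b ^ k" for k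
    using w ac b by (subst pmf_embed_pmf_sums) (auto simp: assms(8))
  have "(\<lambda>k. \<mu>0 (Suc k)) sums (c * sc)"
    using sums_mult[OF summable_sums[OF sm'], of c] unfolding sc_def by (simp add: assms(9) mult.assoc)
  then have "\<mu>0 sums (c * sc + \<mu>0 0)" by (rule sums_Suc)
  then have "\<mu>0 sums 1" using sc c by (simp add: assms(9))
  then have pmf_\<mu>0: "pmf (embed_pmf \<mu>0) k = (if k \<ge> 1 then c * w k * b ^ k else 0)" for k
    using w ac b by (subst pmf_embed_pmf_sums) (auto simp: assms(9))

  \<comment> \<open>Both laws will be \<open>S\<close> divided by its sum over the plane trees with
    \<open>n\<close> vertices.\<close>
  define S where "S \<tau> = (\<Sum>E | E \<in> NC n \<and> shape n E = \<tau>. weight w n E)" for \<tau>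
  let ?A = "{\<tau>. num_vertices \<tau> = n}"
  have S: "S \<tau> = (if \<tau> \<in> ?A then w (length (subtrees \<tau>)) * prod_list (map (shape_weight w) (subtrees \<tau>)) else 0)"
    for \<tau>
    using sum_weight_shape[where n = n and w = w and ts = "subtrees \<tau>"] n unfolding S_def by simp
  have fin: "finite ?A"
  proof (rule finite_subset)
    show "?A \<subseteq> (\<lambda>t. PNode (shapes t)) ` {t. Suc (size t) = n}"
    proof
      fix \<tau> assume \<tau>: "\<tau> \<in> ?A"
      obtain ts where ts: "\<tau> = PNode ts" by (cases \<tau>)
      obtain t where t: "shapes t = ts" using shapes_surj by blast
      then have "Suc (size t) = n" using \<tau> ts by (simp add: size_forest)
      then show "\<tau> \<in> (\<lambda>t. PNode (shapes t)) ` {t. Suc (size t) = n}" using t ts by blast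
    qed
    show "finite ((\<lambda>t. PNode (shapes t)) ` {t. Suc (size t) = n})"
      using bij_betw_finite[OF bij_betw_fedges[of n]] finite_NC n by auto
  qed
  have Z_S: "Z w n = sum S ?A"
  proof -
    have "shape n E \<in> ?A" if E: "E \<in> NC n" for E
    proof -
      obtain t where t: "n = Suc (size t)" "E = fedges t 0 1" using NC_fedges[OF E] by blast
      then show ?thesis using shape_fedges[OF t(1)] by (simp add: size_forest)
    qed
    then have "(\<Sum>\<tau>\<in>?A. \<Sum>E | E \<in> NC n \<and> shape n E = \<tau>. weight w n E) = (\<Sum>E\<in>NC n. weight w n E)"
      by (intro sum.group finite_NC fin) blast
    then show ?thesis unfolding Z_def S_def by simp
  qed
  have BGW_S: "spmf (BGW (embed_pmf \<mu>0) (embed_pmf \<mu>)) \<tau> = c * (a * b) ^ (n - 1) * S \<tau>" if "\<tau> \<in> ?A" for \<tau>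
    using bgw_mass_shape_weight[OF pmf_\<mu> pmf_\<mu>0, where ts = "subtrees \<tau>" and n = n] that n
    by (simp add: spmf_BGW S)
  show ?thesis
  proof (rule spmf_eqI)
    fix \<tau>
    have "spmf (spmf_of_pmf (map_pmf (shape n) (P_NC w n))) \<tau> = measure (P_NC w n) (shape n -` {\<tau>})"
      by (simp add: pmf_map)
    \<comment> \<open>Edge sets outside \<open>NC n\<close> have probability 0, so the preimage can
      be cut down to a finite set.\<close>
    also have "\<dots> = measure (P_NC w n) {E \<in> NC n. shape n E = \<tau>}"
      by (intro measure_pmf.finite_measure_eq_AE AE_pmfI)
        (auto simp: set_pmf_iff pmf_P_NC[OF w n Z] split: if_splits)
    also have "\<dots> = S \<tau> / Z w n"
      unfolding S_def sum_divide_distrib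
      by (subst measure_measure_pmf_finite) (auto simp: finite_NC pmf_P_NC[OF w n Z] intro!: sum.cong)
    also have "\<dots> = spmf (BGW_n n (embed_pmf \<mu>0) (embed_pmf \<mu>)) \<tau>"
    proof (cases "\<tau> \<in> ?A")
      case True
      then show ?thesis
        unfolding BGW_n_def Z_S using BGW_S ac b
        by (subst spmf_cond_spmf_proportional[OF fin, of "c * (a * b) ^ (n - 1)"]) auto
    next
      case False
      then show ?thesis by (simp add: BGW_n_def S)
    qed
    finally show "spmf (spmf_of_pmf (map_pmf (shape n) (P_NC w n))) \<tau> =
        spmf (BGW_n n (embed_pmf \<mu>0) (embed_pmf \<mu>)) \<tau>" .
  qed
qed

end
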